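(* Let $F$ be a $P_7$ or a fork$^+$, and let $H$ be a bull or a hammer. Then the class of $(C_4, F, H)$-free graphs is $\chi$-polydet with a linear binding function; that is, there are a linear function $f$ such that $\chi(G)\le f(\omega(G))$ for every $(C_4,F,H)$-free graph $G$, and a polynomial time algorithm which, given a $(C_4,F,H)$-free graph $G$, determines an $f(\omega(G))$-coloring of $G$.
   Context: All graphs are finite and simple. $C_k$ is the cycle on $k$ vertices and $P_k$ the path on $k$ vertices. A graph is $(H_1,H_2,\dots)$-free if it has no induced subgraph isomorphic to any $H_i$. A bull is a triangle with two disjoint pendant edges (attached at two different vertices of the triangle). A hammer is obtained by identifying an end of $P_3$ with a vertex of a triangle. A fork$^+$ is obtained from $K_{1,3}$ by subdividing one edge twice. A $k$-coloring of $G$ is a proper vertex coloring $V(G)\to\{1,\dots,k\}$. A binding function of a hereditary class $\mathcal G$ is a function $f$ with $\chi(G)\le f(\omega(G))$ for all $G\in\mathcal G$. A class $\mathcal{G}$ is $\chi$-polydet if it has a polynomial binding function $f$ and there is a polynomial time algorithm to determine an $f(\omega(G))$-coloring for each $G\in\mathcal G$. *)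

theory Defs
  imports
    Complex_Main
    "HOL-Computational_Algebra.Polynomial"
    "Graph_Theory.Pair_Digraph"
    "Graph_Theory.Digraph_Component"
    "Graph_Theory.Digraph_Isomorphism"
begin

text \<open>
  A finite simple graph is a pair digraph satisfying the locale predicate
  \<^const>\<open>pair_graph\<close>: an undirected edge is a pair of opposite arcs, and
  two vertices u, v are adjacent iff (u,v) is an arc.
\<close>

section \<open>Special graphs\<close>

definition graph_of :: "'a set \<Rightarrow> ('a \<times> 'a) set \<Rightarrow> 'a pair_pre_digraph" where
  "graph_of V E = \<lparr> pverts = V, parcs = E \<union> E\<inverse> \<rparr>"

definition path_graph :: "nat \<Rightarrow> nat pair_pre_digraph" where
  "path_graph k = graph_of {..<k} {(i, Suc i) | i. Suc i < k}"

text \<open>Only meaningful for k at least 3.\<close>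
definition cycle_graph :: "nat \<Rightarrow> nat pair_pre_digraph" where
  "cycle_graph k = graph_of {..<k} {(i, Suc i mod k) | i. i < k}"

definition bull :: "nat pair_pre_digraph" where
  "bull = graph_of {..<5} {(0,1), (1,2), (0,2), (0,3), (1,4)}"

text \<open>The triangle is 0, 1, 2 and the path on three vertices is 2, 3, 4.\<close>
definition hammer :: "nat pair_pre_digraph" where
  "hammer = graph_of {..<5} {(0,1), (1,2), (0,2), (2,3), (3,4)}"

definition claw :: "nat pair_pre_digraph" where
  "claw = graph_of {..<4} {(0,1), (0,2), (0,3)}"

text \<open>The edge 0--3 of the claw becomes the path 0, 4, 5, 3.\<close>
definition fork_plus :: "nat pair_pre_digraph" where
  "fork_plus = subdivide (subdivide claw (0,3) 4) (4,3) 5"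

section \<open>Induced subgraphs, cliques and colorings\<close>

definition contains_induced :: "'a pair_pre_digraph \<Rightarrow> 'b pair_pre_digraph \<Rightarrow> bool" where
  "contains_induced G H \<longleftrightarrow>
     (\<exists>K. induced_subgraph K (with_proj G) \<and> digraph_iso K (with_proj H))"

definition free_graphs :: "'b pair_pre_digraph set \<Rightarrow> 'a pair_pre_digraph set" where
  "free_graphs \<H> = {G. pair_graph G \<and> (\<forall>H\<in>\<H>. \<not> contains_induced G H)}"

definition clique :: "'a pair_pre_digraph \<Rightarrow> 'a set \<Rightarrow> bool" where
  "clique G S \<longleftrightarrow> S \<subseteq> pverts G \<and> (\<forall>u\<in>S. \<forall>v\<in>S. u \<noteq> v \<longrightarrow> (u, v) \<in> parcs G)"

definition clique_number :: "'a pair_pre_digraph \<Rightarrow> nat" where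
  "clique_number G = Max (card ` {S. clique G S})"

definition coloring :: "'a pair_pre_digraph \<Rightarrow> nat \<Rightarrow> ('a \<Rightarrow> nat) \<Rightarrow> bool" where
  "coloring G k c \<longleftrightarrow>
     (\<forall>v\<in>pverts G. c v \<in> {1..k}) \<and> (\<forall>(u, v)\<in>parcs G. c u \<noteq> c v)"

definition chromatic_number :: "'a pair_pre_digraph \<Rightarrow> nat" where
  "chromatic_number G = (LEAST k. \<exists>c. coloring G k c)"

definition binding_function :: "(nat \<Rightarrow> nat) \<Rightarrow> 'a pair_pre_digraph set \<Rightarrow> bool" where
  "binding_function f \<G> \<longleftrightarrow> (\<forall>G\<in>\<G>. chromatic_number G \<le> f (clique_number G))"

section \<open>Algorithms\<close>

text \<open>
  Algorithms are while programs over a random access memory, at unit cost.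
  The memory consists of finitely many infinite arrays of natural numbers, named by the
  program. Arithmetic is restricted to addition and truncated subtraction, so that
  t steps produce numbers with at most O(t) more bits than the input; multiplication at unit
  cost would break this. Hence running times agree, up to a polynomial, with those of
  Turing machines. A fixed program contains only finitely many expressions, so
  counting the evaluation of an expression as a single step costs a constant factor.
\<close>

type_synonym vname = string
type_synonym state = "vname \<Rightarrow> nat \<Rightarrow> nat"

datatype aexp =
    Num nat
  | Get vname aexp
  | Add aexp aexp
  | Sub aexp aexp

datatype bexp =
    Less aexp aexp
  | Neg bexp
  | Conj bexp bexp

datatype com =
    Skip
  | Assign vname aexp aexp
  | Seq com com
  | Cond bexp com com
  | While bexp com

primrec aval :: "aexp \<Rightarrow> state \<Rightarrow> nat" where
  "aval (Num n) s = n"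
| "aval (Get x a) s = s x (aval a s)"
| "aval (Add a b) s = aval a s + aval b s"
| "aval (Sub a b) s = aval a s - aval b s"

primrec bval :: "bexp \<Rightarrow> state \<Rightarrow> bool" where
  "bval (Less a b) s \<longleftrightarrow> aval a s < aval b s"
| "bval (Neg b) s \<longleftrightarrow> \<not> bval b s"
| "bval (Conj b c) s \<longleftrightarrow> bval b s \<and> bval c s"

text \<open>\<^term>\<open>Assign x i a\<close> stores the value of a in cell i of the array x.\<close>
definition store :: "state \<Rightarrow> vname \<Rightarrow> nat \<Rightarrow> nat \<Rightarrow> state" where
  "store s x i v = s(x := (s x)(i := v))"

text \<open>\<open>exec c s t s'\<close>: started in s, the program c halts in s' after exactly t steps.\<close>
inductive exec :: "com \<Rightarrow> state \<Rightarrow> nat \<Rightarrow> state \<Rightarrow> bool" where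
  Skip: "exec Skip s 1 s"
| Assign: "exec (Assign x i a) s 1 (store s x (aval i s) (aval a s))"
| Seq: "exec c1 s t1 s' \<Longrightarrow> exec c2 s' t2 s'' \<Longrightarrow> exec (Seq c1 c2) s (t1 + t2) s''"
| CondTrue: "bval b s \<Longrightarrow> exec c1 s t s' \<Longrightarrow> exec (Cond b c1 c2) s (Suc t) s'"
| CondFalse: "\<not> bval b s \<Longrightarrow> exec c2 s t s' \<Longrightarrow> exec (Cond b c1 c2) s (Suc t) s'"
| WhileFalse: "\<not> bval b s \<Longrightarrow> exec (While b c) s 1 s"
| WhileTrue: "bval b s \<Longrightarrow> exec c s t1 s' \<Longrightarrow> exec (While b c) s' t2 s'' \<Longrightarrow>
    exec (While b c) s (Suc (t1 + t2)) s''"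

inductive_cases SkipE: "exec Skip s t s'"
inductive_cases AssignE: "exec (Assign x i a) s t s'"
inductive_cases SeqE: "exec (Seq c1 c2) s t s'"
inductive_cases CondE: "exec (Cond b c1 c2) s t s'"
inductive_cases WhileE: "exec (While b c) s t s'"

text \<open>
  Programs are deterministic, so the existential quantifier over the run in
  \<open>poly_time_colorable\<close> below is harmless.
\<close>
lemma exec_deterministic:
  assumes "exec c s t s'" "exec c s u s''"
  shows "u = t \<and> s'' = s'"
  using assms
proof (induction arbitrary: u s'' rule: exec.induct)
  case (Skip s)
  then show ?case by (rule SkipE) simp
next
  case (Assign x i a s)
  then show ?case by (rule AssignE) simp
next
  case (Seq c1 s t1 s' c2 t2 s2)
  from Seq.prems show ?case
    by (rule SeqE) (metis Seq.IH)
next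
  case (CondTrue b s c1 t s' c2)
  from CondTrue.prems show ?case
    by (rule CondE) (use CondTrue.hyps(1) CondTrue.IH in simp_all)
next
  case (CondFalse b s c2 t s' c1)
  from CondFalse.prems show ?case
    by (rule CondE) (use CondFalse.hyps(1) CondFalse.IH in simp_all)
next
  case (WhileFalse b s c)
  from WhileFalse.prems show ?case
    by (rule WhileE) (use WhileFalse.hyps(1) in simp_all)
next
  case (WhileTrue b s c t1 s' t2 s2)
  from WhileTrue.prems show ?case
  proof (rule WhileE)
    assume "\<not> bval b s"
    with WhileTrue.hyps(1) show ?thesis by simp
  next
    fix u1 u2 r
    assume *: "u = Suc (u1 + u2)" "exec c s u1 r" "exec (While b c) r u2 s''"
    from WhileTrue.IH(1)[OF *(2)] have "u1 = t1" "r = s'" by simp_all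
    with WhileTrue.IH(2) * show ?thesis by simp
  qed
qed

text \<open>
  A graph is presented to a program through an arbitrary enumeration vs of its
  vertices: cell 0 of array n holds the number of vertices, and array adj holds the
  adjacency matrix row by row. All other cells are 0.
\<close>
definition adjacency_matrix :: "'a pair_pre_digraph \<Rightarrow> 'a list \<Rightarrow> nat \<Rightarrow> nat" where
  "adjacency_matrix G vs i =
     (let n = length vs in
      if i < n * n \<and> (vs ! (i div n), vs ! (i mod n)) \<in> parcs G then 1 else 0)"

definition graph_input :: "'a pair_pre_digraph \<Rightarrow> 'a list \<Rightarrow> state" where
  "graph_input G vs =
     (\<lambda>x i. 0)(''n'' := (\<lambda>i. 0)(0 := length vs), ''adj'' := adjacency_matrix G vs)"

text \<open>
  The program leaves the color of vertex \<^term>\<open>vs ! i\<close> in cell i of array col.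
  Nothing is required of it on graphs outside \<open>\<G>\<close>. The program and the time
  bound depend on \<open>\<G>\<close> and f only.
\<close>
definition poly_time_colorable :: "(nat \<Rightarrow> nat) \<Rightarrow> 'a pair_pre_digraph set \<Rightarrow> bool" where
  "poly_time_colorable f \<G> \<longleftrightarrow>
     (\<exists>prog. \<exists>p :: nat poly. \<forall>G\<in>\<G>. \<forall>vs. distinct vs \<and> set vs = pverts G \<longrightarrow>
        (\<exists>t s c. exec prog (graph_input G vs) t s \<and> t \<le> poly p (length vs) \<and>
           coloring G (f (clique_number G)) c \<and> (\<forall>i < length vs. s ''col'' i = c (vs ! i))))"

section \<open>chi-polydet classes\<close>

definition polynomial_function :: "(nat \<Rightarrow> nat) \<Rightarrow> bool" where
  "polynomial_function f \<longleftrightarrow> (\<exists>p :: real poly. \<forall>x. real (f x) = poly p (real x))"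

definition linear_function :: "(nat \<Rightarrow> nat) \<Rightarrow> bool" where
  "linear_function f \<longleftrightarrow> (\<exists>a b :: real. \<forall>x. real (f x) = a * real x + b)"

text \<open>The class is chi-polydet, as witnessed by the binding function f.\<close>
definition chi_polydet_with :: "(nat \<Rightarrow> nat) \<Rightarrow> 'a pair_pre_digraph set \<Rightarrow> bool" where
  "chi_polydet_with f \<G> \<longleftrightarrow>
     polynomial_function f \<and> binding_function f \<G> \<and> poly_time_colorable f \<G>"

end

theory Submission
  imports Defs
begin

text \<open>
  The heart of the matter is a degree bound: every nonempty graph in the class has a vertex of
  degree at most 6 \<open>\<omega>\<close>. The class is hereditary, so vertices of small degree can be removed one
  after another. Colouring greedily against this order, always with the smallest colour not yet
  present in the neighbourhood, needs at most 6 \<open>\<omega>\<close> + 1 colours. The order is found by repeatedly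
  removing a vertex of minimum degree. This does not require any knowledge of \<open>\<omega>\<close>, and it takes
  polynomial time.
  
  The degree bound is proved by induction in a stronger form: for every clique K that is not the
  whole graph, some vertex outside K has degree at most 6 \<open>\<omega>\<close>
  (\<open>square_free_graph.low_degree_outside_clique\<close>). A universal vertex may be deleted, because both
  \<open>\<omega>\<close> and the degrees drop by one. If a clique C separates the graph, then K avoids one of the two
  sides, and the induction hypothesis for that side together with C, with C in the role of K,
  yields a vertex in the side itself, all of whose neighbours have been counted. There remain the
  graphs with neither a universal vertex nor a clique separator, called atoms here.
  
  In an atom, the common neighbours of two vertices that are not twins form a clique
  (\<open>common_neighbours_of_nontwins_adj\<close>). For nonadjacent vertices this is just the absence of an
  induced four-cycle. For adjacent vertices u and v, it rests on holes, that is, induced cycles of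
  length at least five. Every vertex u lies on a hole: the neighbours of u that see a fixed component
  of the non-neighbourhood of u separate this component from u, so they do not form a clique, and two
  nonadjacent ones can be joined through the component. On the other hand, no vertex is adjacent
  to all of a hole, since bull- or hammer-freeness would propagate its adjacency to the whole graph
  (\<open>not_complete_to_hole\<close>). Hence a vertex that sees two consecutive vertices of a hole sees exactly
  three consecutive ones, and in hammer-free graphs this is impossible
  (\<open>adj_consecutive_on_hole\<close>). Two nonadjacent common neighbours of u and v contradict this on a
  suitable hole through u.
  
  Now suppose that all vertices outside K had degree greater than 6 \<open>\<omega>\<close>. Then each of them has more
  than 5 \<open>\<omega>\<close> neighbours outside K, while every earlier vertex of a partially embedded tree forbids at
  most \<open>\<omega>\<close> of these. Hence both trees, the path on seven vertices and the subdivided claw, can be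
  embedded greedily as induced subgraphs (\<open>long_induced_path\<close>, \<open>fork_exists\<close>).
  
  The program is verified with Hoare triples that carry a bound on the running time.
\<close>

section \<open>Paths and holes in simple graphs\<close>

locale simple_graph =
  fixes adj :: "'a \<Rightarrow> 'a \<Rightarrow> bool" (infix "\<sim>" 50)
  assumes adj_sym: "a \<sim> b \<Longrightarrow> b \<sim> a"
    and adj_irrefl: "\<not> a \<sim> a"
begin

lemma adj_commute: "a \<sim> b \<longleftrightarrow> b \<sim> a"
  using adj_sym by blast

lemma adj_neq: "a \<sim> b \<Longrightarrow> a \<noteq> b"
  using adj_irrefl by blast

definition complete :: "'a set \<Rightarrow> bool" where
  "complete C \<longleftrightarrow> (\<forall>a\<in>C. \<forall>b\<in>C. a \<noteq> b \<longrightarrow> a \<sim> b)"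

text \<open>
  The triangle is a, b, c; the pendant vertices are d at a and e at b. The stated adjacencies force
  the five vertices to be distinct.
\<close>

definition bull_free :: bool where
  "bull_free \<longleftrightarrow> (\<forall>a b c d e. a \<sim> b \<and> b \<sim> c \<and> a \<sim> c \<and> d \<sim> a \<and> \<not> d \<sim> b \<and> \<not> d \<sim> c \<and>
     e \<sim> b \<and> \<not> e \<sim> a \<and> \<not> e \<sim> c \<longrightarrow> d \<sim> e)"

text \<open>
  The triangle is a, b, c; the pendant path is c, d, e.
\<close>

definition hammer_free :: bool where
  "hammer_free \<longleftrightarrow> (\<forall>a b c d e. a \<sim> b \<and> b \<sim> c \<and> a \<sim> c \<and> d \<sim> c \<and> \<not> d \<sim> a \<and> \<not> d \<sim> b \<and>
     e \<sim> d \<and> \<not> e \<sim> a \<and> \<not> e \<sim> b \<longrightarrow> e \<sim> c)"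

definition clique_separation :: "'a set \<Rightarrow> 'a set \<Rightarrow> 'a set \<Rightarrow> 'a set \<Rightarrow> bool" where
  "clique_separation X A B C \<longleftrightarrow> X = A \<union> B \<union> C \<and> A \<inter> B = {} \<and> (A \<union> B) \<inter> C = {} \<and>
     A \<noteq> {} \<and> B \<noteq> {} \<and> complete C \<and> (\<forall>a\<in>A. \<forall>b\<in>B. \<not> a \<sim> b)"

lemma clique_separation_sym:
  "clique_separation X A B C \<Longrightarrow> clique_separation X B A C"
  unfolding clique_separation_def using adj_sym by (simp add: Un_commute Int_commute) blast

text \<open>
  The form in which separations arise: B is a union of components of the graph minus the clique C.
\<close>

lemma clique_separationI:
  assumes "complete C" "C \<subseteq> X" "B \<subseteq> X - C" "b \<in> B" "d \<in> X - C - B"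
    and "\<And>x y. \<lbrakk>x \<in> B; y \<in> X - C - B\<rbrakk> \<Longrightarrow> \<not> x \<sim> y"
  shows "clique_separation X B (X - C - B) C"
  unfolding clique_separation_def
proof (intro conjI)
  show "X = B \<union> (X - C - B) \<union> C" "B \<inter> (X - C - B) = {}" "(B \<union> (X - C - B)) \<inter> C = {}"
    using assms(2,3) by blast+
  show "B \<noteq> {}" "X - C - B \<noteq> {}" using assms(4,5) by blast+
  show "\<forall>a\<in>B. \<forall>b\<in>X - C - B. \<not> a \<sim> b" using assms(6) by blast
qed (rule assms(1))

definition induced_path_map :: "nat \<Rightarrow> (nat \<Rightarrow> 'a) \<Rightarrow> bool" where
  "induced_path_map k f \<longleftrightarrow> inj_on f {..<k} \<and>
     (\<forall>i<k. \<forall>j<k. f i \<sim> f j \<longleftrightarrow> j = Suc i \<or> i = Suc j)"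

text \<open>
  The fork with one leg subdivided twice is a path on five vertices with one more vertex x attached
  next to an end. The vertex \<open>f 3\<close> is the branch vertex.
\<close>

definition fork_map :: "(nat \<Rightarrow> 'a) \<Rightarrow> 'a \<Rightarrow> bool" where
  "fork_map f x \<longleftrightarrow> induced_path_map 5 f \<and> (\<forall>i<5. f i \<noteq> x \<and> (f i \<sim> x \<longleftrightarrow> i = 3))"

definition steps :: "'a set \<Rightarrow> ('a \<times> 'a) set" where
  "steps W = {(a, b). a \<in> W \<and> b \<in> W \<and> a \<sim> b}"

text \<open>
  A walk of least length is an induced path: a repeated vertex or a chord would give a shortcut.
\<close>

lemma induced_path:
  assumes "(p, q) \<in> (steps W)\<^sup>*"
  obtains f :: "nat \<Rightarrow> 'a" and n where "f 0 = p" "f n = q" "\<And>i. i \<le> n \<Longrightarrow> f i \<in> insert p W"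
    "inj_on f {..n}" "\<And>i j. i \<le> n \<Longrightarrow> j \<le> n \<Longrightarrow> f i \<sim> f j \<longleftrightarrow> j = Suc i \<or> i = Suc j"
proof -
  define n where "n = (LEAST n. (p, q) \<in> steps W ^^ n)"
  have ex: "\<exists>n. (p, q) \<in> steps W ^^ n"
    using assms by (simp add: rtrancl_is_UN_relpow)
  have n: "(p, q) \<in> steps W ^^ n"
    unfolding n_def using ex by (rule LeastI_ex)
  have least: "n \<le> m" if "(p, q) \<in> steps W ^^ m" for m
    unfolding n_def using that by (rule Least_le)
  from n obtain f where f: "f 0 = p" "f n = q" "\<And>i. i < n \<Longrightarrow> (f i, f (Suc i)) \<in> steps W"
    unfolding relpow_fun_conv by blast
  have sub: "(f i, f (i + k)) \<in> steps W ^^ k" if "i + k \<le> n" for i k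
    using that
  proof (induction k)
    case (Suc k)
    then show ?case using f(3)[of "i + k"] by (auto intro: relpow_Suc_I)
  qed simp
  have mem: "f i \<in> insert p W" if "i \<le> n" for i
    using that f(1) f(3)[of "i - 1"] by (cases i) (auto simp: steps_def)
  have neq: "f i \<noteq> f j" if "i < j" "j \<le> n" for i j
  proof
    assume eq: "f i = f j"
    have 1: "(p, f i) \<in> steps W ^^ i" using sub[of 0 i] that f(1) by simp
    have 2: "(f i, q) \<in> steps W ^^ (n - j)" using sub[of j "n - j"] that f(2) eq by simp
    have "(p, q) \<in> steps W ^^ (i + (n - j))"
      by (rule relpow_trans[OF 1 2])
    from least[OF this] that show False by simp
  qed
  have skip: "\<not> f i \<sim> f j" if "Suc i < j" "j \<le> n" for i j
  proof
    assume a: "f i \<sim> f j"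
    have "f i \<in> W" "f j \<in> W"
      using f(3)[of i] f(3)[of "j - 1"] that by (auto simp: steps_def)
    with a have 2: "(f i, f j) \<in> steps W ^^ 1" by (simp add: steps_def)
    have 1: "(p, f i) \<in> steps W ^^ i" using sub[of 0 i] that f(1) by simp
    have 3: "(f j, q) \<in> steps W ^^ (n - j)" using sub[of j "n - j"] that f(2) by simp
    have "(p, q) \<in> steps W ^^ (i + (1 + (n - j)))"
      by (rule relpow_trans[OF 1 relpow_trans[OF 2 3]])
    from least[OF this] that show False by simp
  qed
  have inj: "inj_on f {..n}"
    by (rule linorder_inj_onI') (use neq in auto)
  have adj: "f i \<sim> f j \<longleftrightarrow> j = Suc i \<or> i = Suc j" if "i \<le> n" "j \<le> n" for i j
  proof -
    have s: "f i \<sim> f (Suc i)" if "i < n" for i using f(3)[OF that] by (simp add: steps_def)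
    consider "j = Suc i" | "i = Suc j" | "i = j" | "Suc i < j" | "Suc j < i" by linarith
    then show ?thesis
      using s[of i] s[of j] skip[of i j] skip[of j i] that adj_irrefl adj_commute[of "f i" "f j"]
      by cases auto
  qed
  show thesis by (rule that[OF f(1,2) mem inj adj])
qed

text \<open>
  An induced cycle of length N at least five, indexed by the integers modulo N. Periodic indexing
  makes rotations plain index shifts, so that the arguments below need no wrap-around cases.
\<close>

definition hole :: "'a set \<Rightarrow> (int \<Rightarrow> 'a) \<Rightarrow> int \<Rightarrow> bool" where
  "hole X h N \<longleftrightarrow> 5 \<le> N \<and> range h \<subseteq> X \<and>
     (\<forall>i j. h i = h j \<longleftrightarrow> N dvd j - i) \<and>
     (\<forall>i j. h i \<sim> h j \<longleftrightarrow> N dvd j - i - 1 \<or> N dvd j - i + 1)"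

lemma hole_adj:
  assumes "hole X h N"
  shows "h i \<sim> h j \<longleftrightarrow> N dvd j - i - 1 \<or> N dvd j - i + 1"
  using assms by (simp add: hole_def)

text \<open>
  Length at least five is what keeps vertices at distance three along the cycle nonadjacent; in a
  four-cycle they are neighbours.
\<close>

lemma hole_near:
  assumes "hole X h N"
  shows "j = i + 1 \<or> i = j + 1 \<Longrightarrow> h i \<sim> h j"
    and "j = i + 2 \<or> j = i + 3 \<or> i = j + 2 \<or> i = j + 3 \<Longrightarrow> \<not> h i \<sim> h j \<and> h i \<noteq> h j"
proof -
  have N: "\<not> N dvd k" if "0 < k" "k < 5" for k
    using assms that zdvd_not_zless[of k N] by (auto simp: hole_def)
  have nums: "\<not> N dvd 1" "\<not> N dvd 2" "\<not> N dvd 3" "\<not> N dvd 4" by (rule N; simp)+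
  show "h i \<sim> h j" if "j = i + 1 \<or> i = j + 1"
    using that assms by (auto simp: hole_def)
  show "\<not> h i \<sim> h j \<and> h i \<noteq> h j" if "j = i + 2 \<or> j = i + 3 \<or> i = j + 2 \<or> i = j + 3"
    using that assms nums by (auto simp: hole_def algebra_simps)
qed

lemma hole_periodic:
  assumes "hole X h N" and "N dvd j - i"
  shows "h (i + k) = h (j + k)"
  using assms by (simp add: hole_def)

text \<open>
  Every vertex of the cycle is met when walking forward from a given one. This is how a property
  that fails somewhere on the cycle is seen to fail at a first place ahead.
\<close>

lemma hole_recurrent:
  assumes "hole X h N"
  obtains l where "h k = h (i + int l)"
proof
  have "N \<ge> 1" using assms by (simp add: hole_def)
  then have "\<bar>i - k\<bar> \<le> N * \<bar>i - k\<bar>"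
    using mult_right_mono[of 1 N "\<bar>i - k\<bar>"] by simp
  then have "i - k \<le> N * \<bar>i - k\<bar>" using abs_ge_self order_trans by blast
  then have "i \<le> k + N * \<bar>i - k\<bar>" by (simp only: diff_le_eq add.commute)
  then show "h k = h (i + int (nat (k + N * \<bar>i - k\<bar> - i)))"
    using assms by (simp add: hole_def)
qed

lemma hole_boundary:
  assumes h: "hole X h N" and "x \<sim> h i" and "\<not> x \<sim> h k"
  obtains m where "x \<sim> h m" "\<not> x \<sim> h (m + 1)"
proof (rule ccontr)
  assume "\<not> thesis"
  with that have st: "x \<sim> h m \<Longrightarrow> x \<sim> h (m + 1)" for m by blast
  have "x \<sim> h (i + int l)" for l
  proof (induction l)
    case (Suc l)
    then show ?case using st[of "i + int l"] by (simp add: ac_simps)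
  qed (use assms(2) in simp)
  then show False using assms(3) hole_recurrent[OF h, of k i] by metis
qed

lemma hole_boundary_pair:
  assumes h: "hole X h N" and "x \<sim> h i" "x \<sim> h (i + 1)" and "\<not> x \<sim> h k"
  obtains m where "x \<sim> h m" "x \<sim> h (m + 1)" "\<not> x \<sim> h (m + 2)"
proof (rule ccontr)
  assume "\<not> thesis"
  with that have st: "x \<sim> h m \<Longrightarrow> x \<sim> h (m + 1) \<Longrightarrow> x \<sim> h (m + 2)" for m by blast
  have "x \<sim> h (i + int l) \<and> x \<sim> h (i + int l + 1)" for l
  proof (induction l)
    case (Suc l)
    then show ?case using st[of "i + int l"] by (simp add: ac_simps)
  qed (use assms(2,3) in simp)
  then show False using assms(4) hole_recurrent[OF h, of k i] by metis
qed

text \<open>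
  A vertex u that sees precisely the ends of an induced path on at least four vertices closes it to
  a hole. The vertex u gets index 0, and the path occupies the indices 1 to n + 1.
\<close>

lemma hole_closing_path:
  fixes f :: "nat \<Rightarrow> 'a"
  assumes n: "3 \<le> n" and inj: "inj_on f {..n}"
    and path: "\<And>i j. i \<le> n \<Longrightarrow> j \<le> n \<Longrightarrow> f i \<sim> f j \<longleftrightarrow> j = Suc i \<or> i = Suc j"
    and u: "\<And>i. i \<le> n \<Longrightarrow> u \<sim> f i \<longleftrightarrow> i = 0 \<or> i = n" "\<And>i. i \<le> n \<Longrightarrow> f i \<noteq> u"
    and X: "u \<in> X" "\<And>i. i \<le> n \<Longrightarrow> f i \<in> X"
  obtains h N where "hole X h N" "h 0 = u" "h 1 = f 0" "h (- 1) = f n"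
proof -
  define N where "N = int n + 2"
  define g where "g r = (case r of 0 \<Rightarrow> u | Suc k \<Rightarrow> f k)" for r
  define h where "h i = g (nat (i mod N))" for i
  have eq: "g a = g b \<longleftrightarrow> a = b" if "a \<le> n + 1" "b \<le> n + 1" for a b
    using that inj u(2)[of "a - 1"] u(2)[of "b - 1"] 
    by (auto simp: g_def inj_on_def split: nat.splits)
  have ad: "g a \<sim> g b \<longleftrightarrow> b = Suc a \<or> a = Suc b \<or> a = 0 \<and> b = n + 1 \<or> b = 0 \<and> a = n + 1"
    if "a \<le> n + 1" "b \<le> n + 1" for a b
    using that n u(1)[of "a - 1"] u(1)[of "b - 1"] path[of "a - 1" "b - 1"] adj_irrefl
      adj_commute[of "f (a - 1)" u]
    by (cases a; cases b) (auto simp: g_def)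
  have "hole X h N"
    unfolding hole_def
  proof (intro conjI allI)
    show "5 \<le> N" using n by (simp add: N_def)
    show "range h \<subseteq> X"
    proof
      fix y assume "y \<in> range h"
      then obtain i where y: "y = g (nat (i mod N))" by (auto simp: h_def)
      have "0 \<le> i mod N" "i mod N < N" by (simp_all add: N_def)
      then have "nat (i mod N) \<le> n + 1" unfolding N_def by linarith
      with X show "y \<in> X" by (auto simp: y g_def split: nat.split)
    qed
    fix i j
    obtain a where a: "i mod N = int a" "a \<le> n + 1"
      using that[of "nat (i mod N)"] pos_mod_bound[of N i] pos_mod_sign[of N i] N_def by linarith
    obtain b where b: "j mod N = int b" "b \<le> n + 1"
      using that[of "nat (j mod N)"] pos_mod_bound[of N j] pos_mod_sign[of N j] N_def by linarith
    have dv: "N dvd j - i + k \<longleftrightarrow> N dvd int b - int a + k" for k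
    proof -
      have "j - i + k = (j div N - i div N) * N + (int b - int a + k)"
        using div_mult_mod_eq[of j N] div_mult_mod_eq[of i N] a(1) b(1) by (simp add: left_diff_distrib)
      then show ?thesis by (simp only: dvd_add_times_triv_left_iff)
    qed
    have small: "N dvd k \<longleftrightarrow> k = 0 \<or> k = N \<or> k = - N" if "- 2 * N < k" "k < 2 * N" for k
    proof
      assume "N dvd k"
      then obtain c where c: "k = N * c" by (rule dvdE)
      have "N > 0" by (simp add: N_def)
      have "N * (- 2) < N * c" "N * c < N * 2" using that unfolding c by linarith+
      then have "- 2 < c" "c < 2"
        unfolding mult_less_cancel_left_pos[OF \<open>N > 0\<close>] .
      then have "c = -1 \<or> c = 0 \<or> c = 1" by linarith
      with c show "k = 0 \<or> k = N \<or> k = - N" by auto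
    qed auto
    \<comment> \<open>A difference of two residues, changed by at most one, is a multiple of N only if it is
      0, N or - N.\<close>
    have hg: "h i = g a" "h j = g b" by (simp_all add: h_def a(1) b(1))
    have dv_iff: "N dvd j - i + k \<longleftrightarrow> int b - int a + k = 0 \<or> int b - int a + k = N \<or> int b - int a + k = - N"
      if "- 1 \<le> k" "k \<le> 1" for k
      unfolding dv by (rule small) (use a(2) b(2) that in \<open>simp_all add: N_def\<close>)
    have "N dvd j - i \<longleftrightarrow> a = b"
      using dv_iff[of 0] a(2) b(2) by (simp add: N_def) linarith
    then show "h i = h j \<longleftrightarrow> N dvd j - i"
      unfolding hg eq[OF a(2) b(2)] by blast
    have "N dvd j - i - 1 \<longleftrightarrow> b = Suc a \<or> b = 0 \<and> a = n + 1"
      using dv_iff[of "- 1"] a(2) b(2) by (simp add: N_def) linarith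
    moreover have "N dvd j - i + 1 \<longleftrightarrow> a = Suc b \<or> a = 0 \<and> b = n + 1"
      using dv_iff[of 1] a(2) b(2) by (simp add: N_def) linarith
    ultimately show "h i \<sim> h j \<longleftrightarrow> N dvd j - i - 1 \<or> N dvd j - i + 1"
      unfolding hg ad[OF a(2) b(2)] by blast
  qed
  moreover have "h 0 = u" by (simp add: h_def g_def)
  moreover have "h 1 = f 0"
    by (simp add: h_def g_def N_def)
  moreover have "(- 1) mod N = N - 1"
    by (rule int_mod_pos_eq[of _ _ "-1"]) (simp_all add: N_def)
  then have "h (- 1) = f n" by (simp add: h_def g_def N_def nat_add_distrib)
  ultimately show thesis by (rule that)
qed

end

section \<open>Atoms of square-free graphs without bulls or hammers\<close>

locale square_free_graph = simple_graph +
  assumes square: "\<lbrakk>a \<sim> b; b \<sim> c; c \<sim> d; d \<sim> a; a \<noteq> c; b \<noteq> d\<rbrakk> \<Longrightarrow> a \<sim> c \<or> b \<sim> d"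
begin

lemma common_neighbours_adj:
  assumes "\<not> a \<sim> c" "a \<noteq> c" "b \<sim> a" "b \<sim> c" "d \<sim> a" "d \<sim> c" "b \<noteq> d"
  shows "b \<sim> d"
  using square[of a b c d] assms adj_commute by blast

text \<open>
  The two pendant vertices of a would-be bull cannot be adjacent, since they would form an induced
  four-cycle with the edge between their attachment vertices. So their nonadjacency is automatic.
\<close>

lemma no_bull:
  assumes "bull_free" "a \<sim> b" "b \<sim> c" "a \<sim> c" "d \<sim> a" "\<not> d \<sim> b" "\<not> d \<sim> c"
    "e \<sim> b" "\<not> e \<sim> a" "\<not> e \<sim> c"
  shows False
proof -
  have "d \<sim> e" using assms unfolding bull_free_def by blast
  with common_neighbours_adj[of d b a e] assms show False
    using adj_commute adj_neq by metis
qed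

lemma no_hammer:
  assumes "hammer_free" "a \<sim> b" "b \<sim> c" "a \<sim> c" "d \<sim> c" "\<not> d \<sim> a" "\<not> d \<sim> b"
    "e \<sim> d" "\<not> e \<sim> c"  "\<not> e \<sim> a" "\<not> e \<sim> b"
  shows False
  using assms unfolding hammer_free_def by blast

end

text \<open>
  These are the graphs that the induction for the degree bound cannot take apart.
\<close>

locale atom = square_free_graph +
  fixes X :: "'a set"
  assumes no_separation: "\<not> clique_separation X A B C"
    and no_universal: "a \<in> X \<Longrightarrow> \<exists>x\<in>X. x \<noteq> a \<and> \<not> a \<sim> x"
    and bull_or_hammer: "bull_free \<or> hammer_free"
begin

text \<open>
  Let A be the set of vertices that are adjacent to all of the hole, and suppose that a is in A.
  Since A is a clique, the rest of the graph is connected. If a path leaving the hole reached a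
  vertex x not adjacent to a, then the first such x, its predecessor y and suitable vertices of the
  hole would form a bull or a hammer together with a. So a would be adjacent to every vertex outside
  A, hence universal.
\<close>

lemma not_complete_to_hole:
  assumes hole: "hole X h N" and a: "a \<in> X"
  shows "\<exists>i. \<not> a \<sim> h i"
proof (rule ccontr)
  assume "\<not> ?thesis"
  then have ah: "a \<sim> h i" for i by blast
  define A where "A = {b \<in> X. \<forall>i. b \<sim> h i}"
  have hX: "h i \<in> X" for i using hole by (auto simp: hole_def)
  have near: "h i \<sim> h (i + 1)" "h (i + 1) \<sim> h i" "h (i - 1) \<sim> h i" "h i \<sim> h (i - 1)" for i
    by (rule hole_near(1)[OF hole]; simp)+
  have far: "\<not> h i \<sim> h j \<and> h i \<noteq> h j" if "j = i + 2 \<or> j = i + 3 \<or> i = j + 2 \<or> i = j + 3" for i j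
    using hole_near(2)[OF hole that] .
  have hA: "h i \<in> X - A" for i
    using hX adj_irrefl by (auto simp: A_def)
  have "complete A"
    unfolding complete_def
  proof (intro ballI impI)
    fix b c assume "b \<in> A" "c \<in> A" "b \<noteq> c"
    then show "b \<sim> c"
      using common_neighbours_adj[of "h 0" "h 2" b c] far[of 2 0] by (auto simp: A_def)
  qed
  define B where "B = {x \<in> X - A. (h 0, x) \<in> (steps (X - A))\<^sup>*}"
  have "X - A - B = {}"
  proof (rule ccontr)
    assume "X - A - B \<noteq> {}"
    then obtain d where d: "d \<in> X - A - B" by blast
    have sep: "\<not> x \<sim> y" if "x \<in> B" "y \<in> X - A - B" for x y
    proof
      assume "x \<sim> y"
      with that have "(x, y) \<in> steps (X - A)" by (auto simp: steps_def B_def)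
      with that show False by (auto simp: B_def intro: rtrancl_into_rtrancl)
    qed
    have "h 0 \<in> B" using hA by (simp add: B_def)
    have "clique_separation X B (X - A - B) A"
      by (rule clique_separationI[OF \<open>complete A\<close> _ _ \<open>h 0 \<in> B\<close> d sep]) (auto simp: A_def B_def)
    then show False using no_separation by blast
  qed
  then have conn: "(h 0, x) \<in> (steps (X - A))\<^sup>*" if "x \<in> X - A" for x
    using that by (auto simp: B_def)
  \<comment> \<open>Remembering the property for all neighbours of y, and not for y alone, lets the path bend:
    a vertex x two steps ahead is nonadjacent to the vertex before y.\<close>
  define P where "P y \<longleftrightarrow> a \<sim> y \<and> (\<forall>x\<in>X - A. x \<sim> y \<longrightarrow> a \<sim> x)" for y
  have "a \<in> A" using a ah by (simp add: A_def)
  have skips: "\<not> x \<sim> h j" if "x \<sim> h i" "\<not> a \<sim> x" "j = i + 2 \<or> j = i + 3 \<or> i = j + 2 \<or> i = j + 3" "x \<noteq> a" for x i j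
    using common_neighbours_adj[of "h i" "h j" a x] far[OF that(3)] ah that by blast
  have P_hole: "P (h i)" for i
    unfolding P_def
  proof (intro conjI ballI impI ah)
    fix x assume x: "x \<in> X - A" "x \<sim> h i"
    then have xa: "x \<noteq> a" using \<open>a \<in> A\<close> by blast
    show "a \<sim> x"
    proof (rule ccontr)
      assume nx: "\<not> a \<sim> x"
      note pr = skips[OF x(2) nx _ xa]
      from bull_or_hammer show False
      proof
        assume bf: bull_free
        have "\<not> x \<sim> h (i + 1) \<or> \<not> x \<sim> h (i - 1)"
          using skips[OF _ nx _ xa, of "i + 1" "i - 1"] by auto
        then show False
        proof
          assume n: "\<not> x \<sim> h (i + 1)"
          show False
            by (rule no_bull[OF bf, of "h i" a "h (i + 1)" x "h (i + 3)"])
              (use n x nx ah near far[of "i + 3" i] far[of "i + 3" "i + 1"] adj_commute in auto)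
        next
          assume n: "\<not> x \<sim> h (i - 1)"
          show False
            by (rule no_bull[OF bf, of "h i" a "h (i - 1)" x "h (i - 3)"])
              (use n x nx ah near far[of "i - 3" i] far[of "i - 3" "i - 1"] adj_commute in auto)
        qed
      next
        assume hf: hammer_free
        show False
          by (rule no_hammer[OF hf, of "h (i + 2)" "h (i + 3)" a "h i" x])
            (use pr[of "i + 2"] pr[of "i + 3"] x nx ah near[of "i + 2"] far[of "i + 2" i] far[of "i + 3" i]
              adj_commute in \<open>auto simp: add.assoc\<close>)
      qed
    qed
  qed
  have "P x" if "x \<in> X - A" for x
    using conn[OF that]
  proof (induction rule: rtrancl_induct)
    case base
    show ?case by (rule P_hole)
  next
    case (step y' y)
    then have yy: "y' \<in> X - A" "y \<in> X - A" "y' \<sim> y" by (auto simp: steps_def)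
    have ay: "a \<sim> y" using step.IH yy adj_commute by (auto simp: P_def)
    show ?case
      unfolding P_def
    proof (intro conjI ballI impI ay)
      fix x assume x: "x \<in> X - A" "x \<sim> y"
      then have xa: "x \<noteq> a" using \<open>a \<in> A\<close> by blast
      show "a \<sim> x"
      proof (rule ccontr)
        assume nx: "\<not> a \<sim> x"
        have xh: "\<not> x \<sim> h i" for i using P_hole[of i] x nx by (auto simp: P_def)
        then have yh: "y \<noteq> h i" for i using x by blast
        \<comment> \<open>If y sees the hole, then it sees some \<open>h i\<close> but neither of the next two vertices.
          Otherwise y' takes over the role of \<open>h i\<close> in the bull.\<close>
        have xy': "\<not> x \<sim> y'" using step.IH x nx by (auto simp: P_def)
        obtain k where k: "\<not> y \<sim> h k" using yy by (auto simp: A_def)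
        show False
        proof (cases "\<exists>i. y \<sim> h i")
          case True
          then obtain i where i: "y \<sim> h i" "\<not> y \<sim> h (i + 1)"
            using hole_boundary[OF hole _ k] by blast
          have i2: "\<not> y \<sim> h (i + 2)"
            using common_neighbours_adj[of "h i" "h (i + 2)" y "h (i + 1)"] far[of "i + 2" i] i yh near[of i] near[of "i + 1"]
              adj_commute by (auto simp: add.assoc)
          from bull_or_hammer show False
          proof
            assume bf: bull_free
            show False
              by (rule no_bull[OF bf, of y a "h i" x "h (i + 2)"])
                (use i i2 x nx ay ah xh far[of "i + 2" i] adj_commute in auto)
          next
            assume hf: hammer_free
            show False
              by (rule no_hammer[OF hf, of "h (i + 1)" "h (i + 2)" a y x])
                (use i i2 x nx ay ah xh near[of "i + 1"] adj_commute in \<open>auto simp: add.assoc\<close>)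
          qed
        next
          case False
          then have yn: "\<not> y \<sim> h i" for i by blast
          then have y'h: "y' \<noteq> h i" for i using yy adj_commute by blast
          obtain k' where k': "\<not> y' \<sim> h k'" using yy by (auto simp: A_def)
          from bull_or_hammer show False
          proof
            assume bf: bull_free
            have "a \<sim> y'" using step.IH by (simp add: P_def)
            then show False
              by - (rule no_bull[OF bf, of y a y' x "h k'"],
                use k' yn x nx ay ah xh xy' yy adj_commute in auto)
          next
            assume hf: hammer_free
            show False
              by (rule no_hammer[OF hf, of "h 0" "h 1" a y x])
                (use yn x nx ay ah xh near[of 0] adj_commute in auto)
          qed
        qed
      qed
    qed
  qed
  then have "a \<sim> x" if "x \<in> X" "x \<noteq> a" for x
    using that \<open>complete A\<close> \<open>a \<in> A\<close> by (cases "x \<in> A") (auto simp: P_def complete_def)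
  then show False using no_universal[OF a] by blast
qed

text \<open>
  Walk forward to the last of the consecutive neighbours of x on the hole. The next two vertices
  are both missed by x and form a hammer with the triangle. If there is no bull, the neighbour of
  the triangle on the other side must be seen by x, and moreover every neighbour y of x is adjacent
  to one of the last two neighbours \<open>h m\<close> and \<open>h (m + 1)\<close>; for y on the hole this leaves nothing
  beyond \<open>h (m - 1)\<close>, \<open>h m\<close> and \<open>h (m + 1)\<close>. The two alternatives in the conclusion say which two of
  these three vertices are \<open>h i\<close> and \<open>h (i + 1)\<close>.
\<close>

lemma adj_consecutive_on_hole:
  assumes hole: "hole X h N" and x: "x \<in> X" "x \<sim> h i" "x \<sim> h (i + 1)"
  shows "bull_free" 
    and "x \<sim> h (i - 1) \<and> \<not> x \<sim> h (i + 2) \<or> \<not> x \<sim> h (i - 1) \<and> x \<sim> h (i + 2) \<and> \<not> x \<sim> h (i + 3)"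
proof -
  have near: "h i \<sim> h (i + 1)" "h (i + 1) \<sim> h i" "h (i - 1) \<sim> h i" "h i \<sim> h (i - 1)" for i
    by (rule hole_near(1)[OF hole]; simp)+
  have far: "\<not> h i \<sim> h j \<and> h i \<noteq> h j" if "j = i + 2 \<or> j = i + 3 \<or> i = j + 2 \<or> i = j + 3" for i j
    using hole_near(2)[OF hole that] .
  obtain m where m: "x \<sim> h m" "x \<sim> h (m + 1)" "\<not> x \<sim> h (m + 2)"
    using not_complete_to_hole[OF hole x(1)] hole_boundary_pair[OF hole x(2,3)] by blast
  have xm2: "x \<noteq> h (m + 2)" using far[of m "m + 2"] m(1) by auto
  have m3: "\<not> x \<sim> h (m + 3)"
    using common_neighbours_adj[of "h (m + 1)" "h (m + 3)" x "h (m + 2)"] far[of "m + 3" "m + 1"] m xm2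
      near[of "m + 1"] near[of "m + 2"] adj_commute by (auto simp: add.assoc)
  show bf: bull_free
  proof (rule ccontr)
    assume "\<not> bull_free"
    then have hf: hammer_free using bull_or_hammer by blast
    show False
      by (rule no_hammer[OF hf, of "h m" x "h (m + 1)" "h (m + 2)" "h (m + 3)"])
        (use m m3 near[of m] near[of "m + 1"] near[of "m + 2"] far[of "m + 2" m] far[of "m + 3" m]
          far[of "m + 3" "m + 1"] adj_commute in \<open>auto simp: add.assoc\<close>)
  qed
  have m1: "x \<sim> h (m - 1)"
  proof (rule ccontr)
    assume "\<not> x \<sim> h (m - 1)"
    then show False
      by - (rule no_bull[OF bf, of "h (m + 1)" "h m" x "h (m + 2)" "h (m - 1)"],
        use m near[of m] near[of "m + 1"] far[of "m + 2" m] far[of "m + 1" "m - 1"]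
          adj_commute in \<open>auto simp: add.assoc\<close>)
  qed
  have dom: "y \<sim> h m \<or> y \<sim> h (m + 1)" if "y \<sim> x" for y
  proof (rule ccontr)
    assume "\<not> ?thesis"
    with that show False
      by - (rule no_bull[OF bf, of "h (m + 1)" x "h m" "h (m + 2)" y],
        use m near[of m] near[of "m + 1"] far[of "m + 2" m]
          adj_commute in \<open>auto simp: add.assoc\<close>)
  qed
  have "h i \<sim> h m \<or> h i \<sim> h (m + 1)" using dom[of "h i"] adj_sym[OF x(2)] by simp
  then have *: "N dvd m - i - 1 \<or> N dvd m - i + 1 \<or> N dvd m + 1 - i - 1 \<or> N dvd m + 1 - i + 1"
    unfolding hole_adj[OF hole] by blast
  then have "N dvd (m + (- 1)) - i \<or> N dvd (m + 1) - i \<or> N dvd (m + 0) - i \<or> N dvd (m + 2) - i"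
  proof -
    have "m - i - 1 = m + (- 1) - i" "m - i + 1 = m + 1 - i" "m + 1 - i - 1 = m + 0 - i"
      "m + 1 - i + 1 = m + 2 - i" by simp_all
    then show ?thesis using * by (simp only:)
  qed
  then obtain r where r: "r = - 1 \<or> r = 0 \<or> r = 1 \<or> r = 2" "N dvd (m + r) - i"
    by blast
  have shift: "h (i + k) = h (m + r + k)" for k
    using hole_periodic[OF hole r(2)] .
  have sh: "h i = h (m + r)" "h (i + 1) = h (m + r + 1)" "h (i - 1) = h (m + r - 1)"
    "h (i + 2) = h (m + r + 2)" "h (i + 3) = h (m + r + 3)"
    using shift[of 0] shift[of 1] shift[of "- 1"] shift[of 2] shift[of 3] by simp_all
  have "\<not> x \<sim> h (m - 2)"
    using dom[of "h (m - 2)"] far[of "m - 2" m] far[of "m - 2" "m + 1"] adj_commute by auto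
  show "x \<sim> h (i - 1) \<and> \<not> x \<sim> h (i + 2) \<or> \<not> x \<sim> h (i - 1) \<and> x \<sim> h (i + 2) \<and> \<not> x \<sim> h (i + 3)"
    using r(1)
  proof (elim disjE)
    assume r: "r = - 1"
    show ?thesis using m m1 \<open>\<not> x \<sim> h (m - 2)\<close> unfolding sh r by (simp add: add.commute)
  next
    assume r: "r = 0"
    show ?thesis using m m1 unfolding sh r by (simp add: add.commute)
  next
    assume r: "r = 1"
    show ?thesis using m x(3) unfolding sh r by (simp add: add.commute)
  next
    assume r: "r = 2"
    show ?thesis using m x(2) unfolding sh r by (simp add: add.commute)
  qed
qed

text \<open>
  Z is the component of w in the graph without u and its neighbours, and D is the set of neighbours of
  u attached to Z. As D separates Z from u, it is not a clique. Two nonadjacent vertices of D are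
  joined by a shortest path through Z, and u closes this path to a hole.
\<close>

lemma hole_through:
  assumes X: "u \<in> X" "w \<in> X" "w \<noteq> u" "\<not> w \<sim> u"
  defines "Z \<equiv> {z \<in> X. (w, z) \<in> (steps {x \<in> X. x \<noteq> u \<and> \<not> x \<sim> u})\<^sup>*}"
  defines "D \<equiv> {y \<in> X. y \<sim> u \<and> (\<exists>z\<in>Z. z \<sim> y)}"
  shows "\<exists>p\<in>D. \<exists>q\<in>D. p \<noteq> q \<and> \<not> p \<sim> q"
    and "\<lbrakk>p \<in> D; q \<in> D; p \<noteq> q; \<not> p \<sim> q\<rbrakk> \<Longrightarrow> \<exists>h N. hole X h N \<and> h 0 = u \<and> h 1 = p \<and> h (- 1) = q"
proof -
  define R where "R = {x \<in> X. x \<noteq> u \<and> \<not> x \<sim> u}"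
  have Z_eq: "Z = {z \<in> X. (w, z) \<in> (steps R)\<^sup>*}" by (simp add: Z_def R_def)
  have wZ: "w \<in> Z" using X by (simp add: Z_eq)
  have ZR: "Z \<subseteq> R"
  proof
    fix z assume "z \<in> Z"
    then have "(w, z) \<in> (steps R)\<^sup>*" by (simp add: Z_eq)
    then show "z \<in> R" by (cases rule: rtrancl.cases) (use X in \<open>auto simp: steps_def R_def\<close>)
  qed
  have closed: "y \<in> Z" if "z \<in> Z" "y \<in> R" "z \<sim> y" for z y
  proof -
    have "(z, y) \<in> steps R" using that ZR by (auto simp: steps_def)
    with that show ?thesis by (auto simp: Z_eq R_def intro: rtrancl_into_rtrancl)
  qed
  show "\<exists>p\<in>D. \<exists>q\<in>D. p \<noteq> q \<and> \<not> p \<sim> q"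
  proof (rule ccontr)
    assume "\<not> ?thesis"
    then have "complete D" unfolding complete_def by blast
    have sep: "\<not> z \<sim> y" if "z \<in> Z" "y \<in> X - D - Z" for z y
      using that closed[of z y] ZR by (auto simp: D_def R_def)
    have "u \<in> X - D - Z" using X ZR adj_irrefl by (auto simp: R_def D_def)
    from \<open>complete D\<close> have "clique_separation X Z (X - D - Z) D"
      by (rule clique_separationI[OF _ _ _ wZ \<open>u \<in> X - D - Z\<close> sep]) (use ZR in \<open>auto simp: R_def D_def\<close>)
    then show False using no_separation by blast
  qed
  assume pq: "p \<in> D" "q \<in> D" "p \<noteq> q" "\<not> p \<sim> q"
  then obtain z z' where z: "z \<in> Z" "z \<sim> p" "z' \<in> Z" "z' \<sim> q" by (auto simp: D_def)
  have reach: "(w, y) \<in> (steps Z)\<^sup>*" if "y \<in> Z" for y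
  proof -
    have "(w, y) \<in> (steps R)\<^sup>*" using that by (simp add: Z_eq)
    then show ?thesis
    proof (induction rule: rtrancl_induct)
      case (step a b)
      have wa: "(w, a) \<in> (steps R)\<^sup>*" "(w, b) \<in> (steps R)\<^sup>*"
        using step.hyps by (auto intro: rtrancl_into_rtrancl)
      have "a \<in> X" "b \<in> X" "a \<sim> b" using step.hyps(2) by (auto simp: steps_def R_def)
      with wa have "(a, b) \<in> steps Z" by (auto simp: Z_eq steps_def)
      with step.IH show ?case by (rule rtrancl_into_rtrancl)
    qed simp
  qed
  have sym: "sym (steps Z)" by (auto simp: sym_def steps_def intro: adj_sym)
  define W where "W = insert p (insert q Z)"
  have mono: "steps Z \<subseteq> steps W" by (auto simp: steps_def W_def)
  have "(z, z') \<in> (steps Z)\<^sup>*"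
    using reach[OF z(1)] reach[OF z(3)] sym_rtrancl[OF sym] by (meson rtrancl_trans symD)
  then have "(z, z') \<in> (steps W)\<^sup>*" using rtrancl_mono[OF mono] by blast
  moreover have "(p, z) \<in> steps W" "(z', q) \<in> steps W"
    using z adj_commute by (auto simp: steps_def W_def)
  ultimately have "(p, q) \<in> (steps W)\<^sup>*" by (meson converse_rtrancl_into_rtrancl rtrancl_into_rtrancl)
  from induced_path[OF this] obtain f n where f: "f 0 = p" "f n = q"
    "\<And>i. i \<le> n \<Longrightarrow> f i \<in> insert p W" and inj: "inj_on f {..n}"
    and path: "\<And>i j. i \<le> n \<Longrightarrow> j \<le> n \<Longrightarrow> f i \<sim> f j \<longleftrightarrow> j = Suc i \<or> i = Suc j" by blast
  have inner: "f i \<in> Z" if "i \<le> n" "i \<noteq> 0" "i \<noteq> n" for i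
  proof -
    have "f i \<noteq> f 0" "f i \<noteq> f n" using that inj by (auto simp: inj_on_def)
    then show ?thesis using f(3)[OF that(1)] f(1,2) by (auto simp: W_def)
  qed
  have up: "u \<sim> p" "u \<sim> q" using pq adj_commute by (auto simp: D_def)
  have "3 \<le> n"
  proof (rule ccontr)
    assume "\<not> ?thesis"
    then consider "n = 0" | "n = 1" | "n = 2" by linarith
    then show False
    proof cases
      case 1 then show False using f pq by simp
    next
      case 2 then show False using f pq path[of 0 1] by simp
    next
      case 3
      then have "f 1 \<in> Z" "f 1 \<sim> p" "f 1 \<sim> q"
        using inner[of 1] path[of 1 0] path[of 1 2] f by auto
      then show False using common_neighbours_adj[of p q "f 1" u] pq up ZR by (auto simp: R_def)
    qed
  qed
  have uf: "u \<sim> f i \<longleftrightarrow> i = 0 \<or> i = n" if "i \<le> n" for i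
    using inner[OF that] ZR f up adj_commute by (auto simp: R_def)
  have fu: "f i \<noteq> u" if "i \<le> n" for i
    using inner[OF that] ZR f up adj_irrefl by (cases "i = 0 \<or> i = n") (auto simp: R_def)
  have fX: "f i \<in> X" if "i \<le> n" for i
    using inner[OF that] ZR f pq by (cases "i = 0 \<or> i = n") (auto simp: R_def D_def)
  obtain h N where "hole X h N" "h 0 = u" "h 1 = f 0" "h (- 1) = f n"
    by (rule hole_closing_path[OF \<open>3 \<le> n\<close> inj path uf fu X(1) fX])
  then show "\<exists>h N. hole X h N \<and> h 0 = u \<and> h 1 = p \<and> h (- 1) = q"
    unfolding f(1,2) by blast
qed

text \<open>
  Suppose that p and q are nonadjacent, and consider the component Z of w as in \<open>hole_through\<close>; then
  v is attached to Z. If some q' attached to Z is not adjacent to v, then there is a hole through q',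
  u, v. Both p and q see u and v, so each of them sees exactly one more vertex of the hole, next to u
  or next to v. If they see the same one, it forms a four-cycle with p, q and one of u and v; otherwise
  there is a bull.
  If all vertices attached to Z are adjacent to v, take a hole through u with neighbours p' and q'
  there. It contains exactly the neighbours p', u, q' of v. The absence of bulls makes w adjacent to
  both p' and q', and u, p', w, q' is an induced four-cycle.
\<close>

lemma common_neighbours_of_nontwins_adj:
  assumes X: "u \<in> X" "v \<in> X" "w \<in> X" "p \<in> X" "q \<in> X"
    and uv: "u \<sim> v" and p: "p \<sim> u" "p \<sim> v" and q: "q \<sim> u" "q \<sim> v" "p \<noteq> q"
    and w: "w \<sim> v" "w \<noteq> u" "\<not> w \<sim> u"
  shows "p \<sim> q"
proof (rule ccontr)
  assume npq: "\<not> p \<sim> q"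
  define Z where "Z = {z \<in> X. (w, z) \<in> (steps {x \<in> X. x \<noteq> u \<and> \<not> x \<sim> u})\<^sup>*}"
  define D where "D = {y \<in> X. y \<sim> u \<and> (\<exists>z\<in>Z. z \<sim> y)}"
  note through = hole_through[OF X(1,3) w(2,3), folded Z_def, folded D_def]
  have "w \<in> Z" using X by (simp add: Z_def)
  then have vD: "v \<in> D" using X uv w adj_commute by (auto simp: D_def)
  show False
  proof (cases "\<exists>q'\<in>D. q' \<noteq> v \<and> \<not> q' \<sim> v")
    case True
    then obtain q' where "q' \<in> D" "v \<noteq> q'" "\<not> v \<sim> q'" using adj_sym by blast
    from through(2)[OF vD this(1,2,3)] obtain h N where
      h: "hole X h N" "h 0 = u" "h 1 = v" "h (- 1) = q'" by blast
    have far: "\<not> h i \<sim> h j \<and> h i \<noteq> h j" if "j = i + 2 \<or> j = i + 3 \<or> i = j + 2 \<or> i = j + 3" for i j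
      using hole_near(2)[OF h(1) that] .
    have near: "h 1 \<sim> h 2" "h 2 \<sim> h 3" by (rule hole_near(1)[OF h(1)]; simp)+
    have bf: bull_free and
      alt: "x \<sim> h (- 1) \<and> \<not> x \<sim> h 2 \<or> \<not> x \<sim> h (- 1) \<and> x \<sim> h 2 \<and> \<not> x \<sim> h 3"
      if "x \<in> X" "x \<sim> u" "x \<sim> v" for x
      using adj_consecutive_on_hole[OF h(1), of x 0] h that by simp_all
    have excl: False if "x \<sim> h (- 1)" "\<not> x \<sim> h 2" "y \<sim> h 2" "\<not> y \<sim> h 3"
      "x \<sim> v" "y \<sim> v" "\<not> x \<sim> y" for x y
      by (rule no_bull[OF bf[OF X(4) p], of "h 1" "h 2" y x "h 3"])
        (use that near far[of 3 1] h(3) adj_commute in auto)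
    have "\<not> (p \<sim> h (- 1) \<and> q \<sim> h (- 1))"
      using common_neighbours_adj[of "h (- 1)" "h 1" p q] far[of 1 "- 1"] p q npq h(3) adj_commute by auto
    moreover have "\<not> (p \<sim> h 2 \<and> q \<sim> h 2)"
      using common_neighbours_adj[of "h 0" "h 2" p q] far[of 2 0] p q npq h(2) adj_commute by auto
    moreover have "\<not> q \<sim> p" using npq adj_commute by blast
    ultimately show False
      using alt[OF X(4) p] alt[OF X(5) q(1,2)] excl[of p q] excl[of q p] p(2) q(2) npq by argo
  next
    case False
    from through(1) obtain p' q' where pq': "p' \<in> D" "q' \<in> D" "p' \<noteq> q'" "\<not> p' \<sim> q'" by blast
    from through(2)[OF this] obtain h N where
      h: "hole X h N" "h 0 = u" "h 1 = p'" "h (- 1) = q'" by blast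
    have far: "\<not> h i \<sim> h j \<and> h i \<noteq> h j" if "j = i + 2 \<or> j = i + 3 \<or> i = j + 2 \<or> i = j + 3" for i j
      using hole_near(2)[OF h(1) that] .
    have near: "h 1 \<sim> h 2" "h (- 2) \<sim> h (- 1)" by (rule hole_near(1)[OF h(1)]; simp)+
    have "p' \<noteq> v" using False pq'(2,3,4) adj_sym by metis
    moreover have "q' \<noteq> v" using False pq'(1,3,4) by metis
    ultimately have v: "v \<sim> p'" "v \<sim> q'"
      using False pq'(1,2) adj_commute[of v p'] adj_commute[of v q'] by blast+
    have vu: "v \<sim> u" using uv adj_commute by blast
    have bf: bull_free and v2: "\<not> v \<sim> h 2"
      using adj_consecutive_on_hole[OF h(1) X(2), of 0] h v vu by simp_all
    have v2': "\<not> v \<sim> h (- 2)"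
      using adj_consecutive_on_hole(2)[OF h(1) X(2), of "- 1"] h v vu by simp
    have pu: "p' \<sim> u" "q' \<sim> u" using pq' by (auto simp: D_def)
    have "w \<sim> p'"
    proof (rule ccontr)
      assume "\<not> w \<sim> p'"
      then show False
        by - (rule no_bull[OF bf, of v p' u w "h 2"],
          use w v v2 pu near h far[of 2 0] vu adj_commute in auto)
    qed
    moreover have "w \<sim> q'"
    proof (rule ccontr)
      assume "\<not> w \<sim> q'"
      then show False
        by - (rule no_bull[OF bf, of v q' u w "h (- 2)"],
          use w v v2' pu near h far[of "- 2" 0] vu adj_commute in auto)
    qed
    ultimately show False
      using common_neighbours_adj[of p' q' w u] pq'(3,4) w pu adj_sym by blast
  qed
qed

end

section \<open>A vertex of small degree\<close>

context atom
begin

text \<open>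
  Distinct vertices that are not adjacent twins. In the greedy embedding, the witness for an adjacent
  pair is another vertex of the tree.
\<close>

definition separated :: "'a \<Rightarrow> 'a \<Rightarrow> bool" where
  "separated u v \<longleftrightarrow> u \<noteq> v \<and> (u \<sim> v \<longrightarrow> (\<exists>w\<in>X. w \<sim> u \<and> w \<noteq> v \<and> \<not> w \<sim> v \<or> w \<sim> v \<and> w \<noteq> u \<and> \<not> w \<sim> u))"

lemma separated_nonadj: "u \<noteq> v \<Longrightarrow> \<not> u \<sim> v \<Longrightarrow> separated u v"
  by (simp add: separated_def)

lemma separated_witness:
  "\<lbrakk>u \<noteq> v; w \<in> X; w \<sim> v; w \<noteq> u; \<not> w \<sim> u\<rbrakk> \<Longrightarrow> separated u v"
  by (auto simp: separated_def)

lemma complete_common_neighbours: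
  assumes X: "u \<in> X" "v \<in> X" and sep: "separated u v"
  shows "complete {x \<in> X. x \<sim> v \<and> (x = u \<or> x \<sim> u)}"
  unfolding complete_def
proof (intro ballI impI)
  fix p q assume p: "p \<in> {x \<in> X. x \<sim> v \<and> (x = u \<or> x \<sim> u)}"
    and q: "q \<in> {x \<in> X. x \<sim> v \<and> (x = u \<or> x \<sim> u)}" and "p \<noteq> q"
  show "p \<sim> q"
  proof (cases "p = u \<or> q = u")
    case True
    with p q \<open>p \<noteq> q\<close> show ?thesis using adj_sym by blast
  next
    case False
    with p q have pq: "p \<in> X" "q \<in> X" "p \<sim> v" "q \<sim> v" "p \<sim> u" "q \<sim> u" by auto
    show ?thesis
    proof (cases "u \<sim> v")
      case True
      then obtain w where "w \<in> X" and w: "w \<sim> u \<and> w \<noteq> v \<and> \<not> w \<sim> v \<or> w \<sim> v \<and> w \<noteq> u \<and> \<not> w \<sim> u"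
        using sep by (auto simp: separated_def)
      from w show ?thesis
      proof
        assume "w \<sim> u \<and> w \<noteq> v \<and> \<not> w \<sim> v"
        then show ?thesis
          using common_neighbours_of_nontwins_adj[OF X(2,1) \<open>w \<in> X\<close> pq(1,2) adj_sym[OF True] pq(3,5,4,6) \<open>p \<noteq> q\<close>]
          by blast
      next
        assume "w \<sim> v \<and> w \<noteq> u \<and> \<not> w \<sim> u"
        then show ?thesis
          using common_neighbours_of_nontwins_adj[OF X \<open>w \<in> X\<close> pq(1,2) True pq(5,3,6,4) \<open>p \<noteq> q\<close>] by blast
      qed
    next
      case False
      then show ?thesis
        using common_neighbours_adj[of u v p q] sep pq \<open>p \<noteq> q\<close> by (simp add: separated_def)
    qed
  qed
qed

text \<open>
  Y is the complement of a clique K of size at most \<open>\<omega>\<close>. All embeddings take place inside Y, but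
  twins and degrees are understood in X.
\<close>

context
  fixes \<omega> :: nat and Y :: "'a set"
  assumes finite_X: "finite X" and YX: "Y \<subseteq> X" and Y: "Y \<noteq> {}"
    and clique_bound: "\<And>C. C \<subseteq> X \<Longrightarrow> complete C \<Longrightarrow> card C \<le> \<omega>"
    and degree: "\<And>y. y \<in> Y \<Longrightarrow> 5 * \<omega> < card {x \<in> Y. y \<sim> x}"
begin

text \<open>
  Each of the at most five vertices of S excludes a clique of neighbours of t, hence at most \<open>\<omega>\<close> of
  the more than 5 \<open>\<omega>\<close> neighbours in Y.
\<close>

lemma private_neighbour:
  assumes t: "t \<in> Y" and S: "S \<subseteq> Y" "finite S" "card S \<le> 5" and sep: "\<And>s. s \<in> S \<Longrightarrow> separated s t"
  obtains x where "x \<in> Y" "t \<sim> x" "\<And>s. s \<in> S \<Longrightarrow> x \<noteq> s \<and> \<not> s \<sim> x"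
proof -
  define bad where "bad s = {x \<in> X. x \<sim> t \<and> (x = s \<or> x \<sim> s)}" for s
  have "card (bad s) \<le> \<omega>" if "s \<in> S" for s
    unfolding bad_def using complete_common_neighbours[OF _ _ sep[OF that]] t S that YX
    by (intro clique_bound) auto
  then have "(\<Sum>s\<in>S. card (bad s)) \<le> card S * \<omega>"
    using sum_bounded_above[of S "\<lambda>s. card (bad s)" \<omega>] by simp
  then have "card (\<Union>s\<in>S. bad s) \<le> card S * \<omega>"
    using card_UN_le[OF S(2), of bad] by linarith
  also have "\<dots> \<le> 5 * \<omega>" using S(3) by simp
  also have "\<dots> < card {x \<in> Y. t \<sim> x}" by (rule degree[OF t])
  finally have "\<not> {x \<in> Y. t \<sim> x} \<subseteq> (\<Union>s\<in>S. bad s)"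
    using card_mono[of "\<Union>s\<in>S. bad s" "{x \<in> Y. t \<sim> x}"] S(2) finite_X by (auto simp: bad_def)
  then obtain x where "x \<in> Y" "t \<sim> x" "x \<notin> (\<Union>s\<in>S. bad s)" by blast
  with that[of x] YX show thesis
    unfolding bad_def by (auto dest: adj_sym)
qed

text \<open>
  The induction starts with three vertices rather than two, because an edge inside a twin class could
  not be extended: two nonadjacent neighbours of a vertex exist, as its neighbourhood is too large
  to be a clique. From then on, the last two vertices are told apart by their predecessor. Up to the
  seventh vertex, at most five vertices other than the end have to be avoided.
\<close>

lemma long_induced_path:
  assumes "3 \<le> k" "k \<le> 7"
  shows "\<exists>f. induced_path_map k f \<and> (\<forall>i<k. f i \<in> Y)"
  using assms
proof (induction k rule: dec_induct)
  case base
  obtain v where v: "v \<in> Y" using Y by blast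
  have "\<not> complete {x \<in> Y. v \<sim> x}"
  proof
    assume "complete {x \<in> Y. v \<sim> x}"
    then have "card {x \<in> Y. v \<sim> x} \<le> \<omega>" using YX by (intro clique_bound) auto
    then show False using degree[OF v] by simp
  qed
  then obtain p q where pq: "p \<in> Y" "q \<in> Y" "v \<sim> p" "v \<sim> q" "p \<noteq> q" "\<not> p \<sim> q"
    unfolding complete_def by blast
  define f where "f i = (if i = 0 then p else if i = 1 then v else q)" for i :: nat
  have "induced_path_map 3 f"
    using pq adj_irrefl adj_commute
    by (auto simp: induced_path_map_def f_def inj_on_def numeral_3_eq_3 less_Suc_eq)
  moreover have "\<forall>i<3. f i \<in> Y" using pq v by (simp add: f_def)
  ultimately show ?case by blast
next
  case (step k)
  then obtain f where f: "induced_path_map k f" "\<And>i. i < k \<Longrightarrow> f i \<in> Y" by auto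
  have fadj: "f i \<sim> f j \<longleftrightarrow> j = Suc i \<or> i = Suc j" if "i < k" "j < k" for i j
    using f(1) that by (simp add: induced_path_map_def)
  have inj: "inj_on f {..<k}" using f(1) by (simp add: induced_path_map_def)
  define t where "t = f (k - 1)"
  have "separated s t" if "s \<in> f ` {..<k - 1}" for s
  proof -
    from that obtain i where i: "i < k - 1" "s = f i" by blast
    have "s \<noteq> t"
    proof
      assume "s = t"
      then have "f i = f (k - 1)" using i(2) by (simp only: t_def)
      then have "i = k - 1" by (rule inj_onD[OF inj]) (use i(1) in auto)
      then show False using i by simp
    qed
    moreover have "\<exists>w\<in>X. w \<sim> s \<and> w \<noteq> t \<and> \<not> w \<sim> t" if "s \<sim> t"
    proof -
      \<comment> \<open>The only neighbour of the end on the path is its predecessor.\<close>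
      have ik: "i = k - 2" using that fadj[of i "k - 1"] i by (auto simp: t_def)
      obtain m where k: "k = m + 3" using step.hyps(1) by (metis le_add_diff_inverse2)
      have "f m \<sim> s" using fadj[of m "m + 1"] i ik k by simp
      moreover have "\<not> f m \<sim> t" using fadj[of m "m + 2"] k by (simp add: t_def)
      moreover have "f m \<noteq> t" unfolding t_def
        using inj_on_eq_iff[OF inj, of m "k - 1"] k by simp
      moreover have "f m \<in> X" using f(2)[of m] k YX by auto
      ultimately show ?thesis by blast
    qed
    ultimately show ?thesis unfolding separated_def by blast
  qed
  moreover have "card (f ` {..<k - 1}) \<le> 5"
    using card_image_le[of "{..<k - 1}" f] step.prems by simp
  moreover have "t \<in> Y" "f ` {..<k - 1} \<subseteq> Y" using f(2) step.hyps by (auto simp: t_def)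
  ultimately obtain x where x: "x \<in> Y" "t \<sim> x"
    "\<And>s. s \<in> f ` {..<k - 1} \<Longrightarrow> x \<noteq> s \<and> \<not> s \<sim> x"
    using private_neighbour[of t "f ` {..<k - 1}"] by blast
  have xi: "x \<noteq> f i \<and> (f i \<sim> x \<longleftrightarrow> i = k - 1)" if "i < k" for i
    using x(2) x(3)[of "f i"] that adj_neq by (cases "i = k - 1") (auto simp: t_def)
  have "induced_path_map (Suc k) (f(k := x))"
    unfolding induced_path_map_def
  proof (intro conjI allI impI)
    show "inj_on (f(k := x)) {..<Suc k}"
      using inj xi by (auto simp: inj_on_def lessThan_Suc)
    fix i j assume "i < Suc k" "j < Suc k"
    then consider "i < k" "j < k" | "i = k" "j < k" | "i < k" "j = k" | "i = k" "j = k" by linarith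
    then show "(f(k := x)) i \<sim> (f(k := x)) j \<longleftrightarrow> j = Suc i \<or> i = Suc j"
    proof cases
      case 1 then show ?thesis using fadj[of i j] by simp
    next
      case 2 then show ?thesis using xi[of j] adj_commute[of x "f j"] step.hyps by auto
    next
      case 3 then show ?thesis using xi[of i] step.hyps by auto
    next
      case 4 then show ?thesis using adj_irrefl by simp
    qed
  qed
  moreover have "\<forall>i<Suc k. (f(k := x)) i \<in> Y" using f(2) x(1) by (simp add: less_Suc_eq)
  ultimately show ?case by blast
qed

lemma fork_exists: "\<exists>f x. fork_map f x"
proof -
  obtain f where f: "induced_path_map 5 f" "\<And>i. i < 5 \<Longrightarrow> f i \<in> Y"
    using long_induced_path[of 5] by auto
  have fadj: "f i \<sim> f j \<longleftrightarrow> j = Suc i \<or> i = Suc j" if "i < 5" "j < 5" for i j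
    using f(1) that by (simp add: induced_path_map_def)
  have fneq: "f i \<noteq> f j" if "i < 5" "j < 5" "i \<noteq> j" for i j
    using f(1) that by (auto simp: induced_path_map_def inj_on_def)
  have "separated s (f 3)" if "s \<in> f ` {0, 1, 2, 4}" for s
  proof -
    have X: "f 2 \<in> X" "f 4 \<in> X" using f(2) YX by auto
    have "separated (f 0) (f 3)" "separated (f 1) (f 3)"
      by (rule separated_nonadj; use fadj fneq in simp)+
    moreover have "separated (f 2) (f 3)"
      by (rule separated_witness[OF _ X(2)]; use fadj fneq in simp)
    moreover have "separated (f 4) (f 3)"
      by (rule separated_witness[OF _ X(1)]; use fadj fneq in simp)
    ultimately show ?thesis using that by blast
  qed
  moreover have "card (f ` {0, 1, 2, 4}) \<le> 5" using card_image_le[of "{0, 1, 2, 4::nat}" f] by simp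
  ultimately obtain x where x: "x \<in> Y" "f 3 \<sim> x"
    "\<And>s. s \<in> f ` {0, 1, 2, 4} \<Longrightarrow> x \<noteq> s \<and> \<not> s \<sim> x"
    using private_neighbour[of "f 3" "f ` {0, 1, 2, 4}"] f(2) by auto
  have "f i \<noteq> x \<and> (f i \<sim> x \<longleftrightarrow> i = 3)" if "i < 5" for i
  proof -
    have "i = 3 \<or> i \<in> {0, 1, 2, 4}" using that by auto
    then show ?thesis using x(2) x(3)[of "f i"] adj_neq by auto
  qed
  with f(1) show ?thesis unfolding fork_map_def by blast
qed

end

text \<open>
  Removing K costs at most \<open>\<omega>\<close> neighbours, which leaves more than 5 \<open>\<omega>\<close> for the embeddings.
\<close>

lemma low_degree_outside_clique_of_atom:
  assumes fin: "finite X" and K: "K \<subseteq> X" "complete K" "K \<noteq> X"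
    and clique_bound: "\<And>C. C \<subseteq> X \<Longrightarrow> complete C \<Longrightarrow> card C \<le> \<omega>"
    and tree: "(\<nexists>f. induced_path_map 7 f) \<or> (\<nexists>f x. fork_map f x)"
  shows "\<exists>v\<in>X - K. card {x \<in> X. v \<sim> x} \<le> 6 * \<omega>"
proof (rule ccontr)
  assume "\<not> ?thesis"
  then have big: "6 * \<omega> < card {x \<in> X. v \<sim> x}" if "v \<in> X - K" for v
    using that by (meson not_le)
  have deg: "5 * \<omega> < card {x \<in> X - K. v \<sim> x}" if "v \<in> X - K" for v
  proof -
    have "card {x \<in> X. v \<sim> x} \<le> card ({x \<in> X - K. v \<sim> x} \<union> K)"
      using fin K(1) by (intro card_mono) (auto intro: finite_subset)
    also have "\<dots> \<le> card {x \<in> X - K. v \<sim> x} + card K" by (rule card_Un_le)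
    also have "card K \<le> \<omega>" using K clique_bound by blast
    finally show ?thesis using big[OF that] by linarith
  qed
  have ne: "X - K \<subseteq> X" "X - K \<noteq> {}" using K by auto
  show False
    using tree long_induced_path[OF fin ne clique_bound deg, of 7] fork_exists[OF fin ne clique_bound deg]
    by auto
qed

end

text \<open>
  The clique K is what makes the induction pass through a clique separator C. A vertex of C may have
  neighbours on both sides, so a low degree inside one part is informative only for vertices
  outside C.
\<close>

lemma (in square_free_graph) low_degree_outside_clique:
  assumes bull_or_hammer: "bull_free \<or> hammer_free"
    and tree: "(\<nexists>f. induced_path_map 7 f) \<or> (\<nexists>f x. fork_map f x)"
    and "finite X" "K \<subseteq> X" "complete K" "K \<noteq> X"
    and "\<And>C. C \<subseteq> X \<Longrightarrow> complete C \<Longrightarrow> card C \<le> \<omega>"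
  shows "\<exists>v\<in>X - K. card {x \<in> X. v \<sim> x} \<le> 6 * \<omega>"
  using assms(3-)
proof (induction "card X" arbitrary: X K \<omega> rule: less_induct)
  case less
  note clique_bound = less.prems(5)
  consider (separation) A B C where "clique_separation X A B C"
    | (universal) a where "a \<in> X" "\<And>x. x \<in> X \<Longrightarrow> x \<noteq> a \<Longrightarrow> a \<sim> x"
    | (atom) "\<And>A B C. \<not> clique_separation X A B C"
      "\<And>a. a \<in> X \<Longrightarrow> \<exists>x\<in>X. x \<noteq> a \<and> \<not> a \<sim> x"
    by blast
  then show ?case
  proof cases
    case separation
    have "K \<inter> A = {} \<or> K \<inter> B = {}"
    proof (rule ccontr)
      assume "\<not> ?thesis"
      then obtain a b where ab: "a \<in> K" "a \<in> A" "b \<in> K" "b \<in> B" by blast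
      then have "a \<noteq> b" "\<not> a \<sim> b" using separation by (auto simp: clique_separation_def)
      with ab show False using less.prems(3) by (simp add: complete_def)
    qed
    then obtain A B where sep: "clique_separation X A B C" and KA: "K \<inter> A = {}"
      using separation clique_separation_sym by blast
    then have X: "X = A \<union> B \<union> C" and disj: "A \<inter> B = {}" "(A \<union> B) \<inter> C = {}"
      and ne: "A \<noteq> {}" "B \<noteq> {}" and C: "complete C" and no_edge: "\<forall>a\<in>A. \<forall>b\<in>B. \<not> a \<sim> b"
      unfolding clique_separation_def by simp_all
    have "A \<union> C \<subset> X" using X disj ne by blast
    then have smaller: "card (A \<union> C) < card X" using less.prems(1) by (rule psubset_card_mono[rotated])
    have fin: "finite (A \<union> C)" using less.prems(1) X by simp
    have neq: "C \<noteq> A \<union> C" using disj(2) ne(1) by blast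
    have bound: "card D \<le> \<omega>" if "D \<subseteq> A \<union> C" "complete D" for D
      using clique_bound[of D] that X by blast
    have "\<exists>v\<in>A \<union> C - C. card {x \<in> A \<union> C. v \<sim> x} \<le> 6 * \<omega>"
      by (rule less.hyps[OF smaller fin _ C neq bound]) simp
    then obtain v where v: "v \<in> A \<union> C - C" "card {x \<in> A \<union> C. v \<sim> x} \<le> 6 * \<omega>" ..
    have "{x \<in> X. v \<sim> x} = {x \<in> A \<union> C. v \<sim> x}" using v(1) X no_edge by blast
    with v(2) have "card {x \<in> X. v \<sim> x} \<le> 6 * \<omega>" by (simp only:)
    moreover have "v \<in> X - K" using v(1) X KA by blast
    ultimately show ?thesis ..
  next
    case universal
    have one: "Suc (card C) \<le> \<omega>" if "C \<subseteq> X - {a}" "complete C" for C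
    proof -
      have "complete (insert a C)"
        using that universal adj_sym unfolding complete_def by blast
      then have "card (insert a C) \<le> \<omega>" using that universal(1) by (intro clique_bound) auto
      moreover have "finite C" "a \<notin> C" using that less.prems(1) by (auto intro: finite_subset)
      ultimately show ?thesis by simp
    qed
    show ?thesis
    proof (cases "X - {a} \<subseteq> K")
      case True
      then have aK: "a \<in> X - K" using less.prems(2,4) universal(1) by blast
      have "card {x \<in> X. a \<sim> x} \<le> card K"
        using True less.prems(1,2) adj_irrefl by (intro card_mono) (auto intro: finite_subset)
      also have "\<dots> \<le> \<omega>" using less.prems(2,3) by (intro clique_bound)
      finally show ?thesis using aK by (intro bexI[of _ a]) auto
    next
      case False
      have smaller: "card (X - {a}) < card X" using less.prems(1) universal(1) by (rule card_Diff1_less)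
      have "complete (K - {a})" using less.prems(3) by (auto simp: complete_def)
      moreover have "card C \<le> \<omega> - 1" if "C \<subseteq> X - {a}" "complete C" for C
        using one[OF that] by simp
      moreover have "finite (X - {a})" "K - {a} \<subseteq> X - {a}" "K - {a} \<noteq> X - {a}"
        using less.prems(1,2) False by auto
      ultimately have "\<exists>v\<in>X - {a} - (K - {a}). card {x \<in> X - {a}. v \<sim> x} \<le> 6 * (\<omega> - 1)"
        by (intro less.hyps[OF smaller])
      then obtain v where v: "v \<in> X - {a} - (K - {a})" "card {x \<in> X - {a}. v \<sim> x} \<le> 6 * (\<omega> - 1)" ..
      have "card {x \<in> X. v \<sim> x} \<le> card (insert a {x \<in> X - {a}. v \<sim> x})"
        using less.prems(1) by (intro card_mono) auto
      also have "\<dots> \<le> Suc (card {x \<in> X - {a}. v \<sim> x})" by (rule card_insert_le_m1) auto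
      finally have "card {x \<in> X. v \<sim> x} \<le> 6 * \<omega>"
        using v(2) one[of "{}"] by (simp add: complete_def)
      then show ?thesis using v(1) by blast
    qed
  next
    case atom
    interpret atom adj X
      by unfold_locales (use atom bull_or_hammer in auto)
    show ?thesis
      by (rule low_degree_outside_clique_of_atom[OF less.prems(1-4) clique_bound tree])
  qed
qed

section \<open>Timed Hoare triples\<close>

text \<open>
  Total correctness, with T bounding the number of steps of the run.
\<close>

definition triple :: "(state \<Rightarrow> bool) \<Rightarrow> nat \<Rightarrow> com \<Rightarrow> (state \<Rightarrow> bool) \<Rightarrow> bool" where
  "triple P T c Q \<longleftrightarrow> (\<forall>s. P s \<longrightarrow> (\<exists>t s'. exec c s t s' \<and> t \<le> T \<and> Q s'))"

lemma triple_seq: "triple P T c R \<Longrightarrow> triple R U d Q \<Longrightarrow> triple P (T + U) (Seq c d) Q"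
  unfolding triple_def by (meson Seq add_mono)

lemma triple_conseq:
  "triple P T c Q \<Longrightarrow> (\<And>s. P' s \<Longrightarrow> P s) \<Longrightarrow> (\<And>s. Q s \<Longrightarrow> Q' s) \<Longrightarrow> triple P' T c Q'"
  unfolding triple_def by blast

text \<open>
  Fixing the initial state allows a postcondition to refer to it.
\<close>

lemma triple_pointwise: "(\<And>s0. P s0 \<Longrightarrow> triple (\<lambda>s. s = s0) T c Q) \<Longrightarrow> triple P T c Q"
  unfolding triple_def by blast

primrec loop_free :: "com \<Rightarrow> bool" where
  "loop_free Skip \<longleftrightarrow> True"
| "loop_free (Assign x i a) \<longleftrightarrow> True"
| "loop_free (Seq c d) \<longleftrightarrow> loop_free c \<and> loop_free d"
| "loop_free (Cond b c d) \<longleftrightarrow> loop_free c \<and> loop_free d"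
| "loop_free (While b c) \<longleftrightarrow> False"

text \<open>
  The state transformer of a loop-free program; the clause for loops is a dummy.
\<close>

primrec effect :: "com \<Rightarrow> state \<Rightarrow> state" where
  "effect Skip s = s"
| "effect (Assign x i a) s = store s x (aval i s) (aval a s)"
| "effect (Seq c d) s = effect d (effect c s)"
| "effect (Cond b c d) s = (if bval b s then effect c s else effect d s)"
| "effect (While b c) s = s"

lemma exec_loop_free: "loop_free c \<Longrightarrow> \<exists>t. exec c s t (effect c s) \<and> t \<le> size c + 1"
proof (induction c arbitrary: s)
  case Skip
  show ?case by (auto intro!: exI[of _ 1] exec.Skip)
next
  case (Assign x i a)
  show ?case by (auto intro!: exI[of _ 1] exec.Assign)
next
  case (Seq c d)
  from Seq.prems Seq.IH(1)[of s] Seq.IH(2)[of "effect c s"] obtain t u where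
    "exec c s t (effect c s)" "t \<le> size c + 1"
    "exec d (effect c s) u (effect d (effect c s))" "u \<le> size d + 1" by auto
  then show ?case by (auto intro!: exI[of _ "t + u"] exec.Seq)
next
  case (Cond b c d)
  show ?case
  proof (cases "bval b s")
    case True
    from Cond.prems Cond.IH(1)[of s] obtain t where "exec c s t (effect c s)" "t \<le> size c + 1" by auto
    with True show ?thesis by (auto intro!: exI[of _ "Suc t"] exec.CondTrue)
  next
    case False
    from Cond.prems Cond.IH(2)[of s] obtain t where "exec d s t (effect d s)" "t \<le> size d + 1" by auto
    with False show ?thesis by (auto intro!: exI[of _ "Suc t"] exec.CondFalse)
  qed
qed simp

lemma triple_loop_free:
  "loop_free c \<Longrightarrow> (\<And>s. P s \<Longrightarrow> Q (effect c s)) \<Longrightarrow> triple P (size c + 1) c Q"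
  unfolding triple_def using exec_loop_free by blast

abbreviation var :: "vname \<Rightarrow> aexp" where
  "var x \<equiv> Get x (Num 0)"

abbreviation assign :: "vname \<Rightarrow> aexp \<Rightarrow> com" where
  "assign x a \<equiv> Assign x (Num 0) a"

text \<open>
  Runs the body with x = 0, ..., n - 1, where n is the number of vertices, kept by the input in
  the array of that name.
\<close>

definition count_loop :: "vname \<Rightarrow> com \<Rightarrow> com" where
  "count_loop x c = Seq (assign x (Num 0))
     (While (Less (var x) (var ''n'')) (Seq c (assign x (Add (var x) (Num 1)))))"

definition loop_time :: "nat \<Rightarrow> nat \<Rightarrow> nat" where
  "loop_time n T = n * (T + 2) + 2"

text \<open>
  The stability premise says that the invariant ignores the loop variable. This lets the body be
  specified without the final increment.
\<close>

lemma triple_count_loop: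
  assumes size: "\<And>k s. I k s \<Longrightarrow> s ''n'' 0 = n"
    and stable: "\<And>k s v. I k s \<Longrightarrow> I k (store s x 0 v)"
    and body: "\<And>k. k < n \<Longrightarrow> triple (\<lambda>s. I k s \<and> s x 0 = k) T c (\<lambda>s. I (Suc k) s \<and> s x 0 = k)"
  shows "triple (I 0) (loop_time n T) (count_loop x c) (I n)"
proof -
  let ?W = "While (Less (var x) (var ''n'')) (Seq c (assign x (Add (var x) (Num 1))))"
  have while: "\<exists>t s'. exec ?W s t s' \<and> t \<le> (n - k) * (T + 2) + 1 \<and> I n s'"
    if "I k s" "s x 0 = k" "k \<le> n" for k s
    using that(3,1,2)
  proof (induction k arbitrary: s rule: inc_induct)
    case base
    then have "\<not> bval (Less (var x) (var ''n'')) s" using size by simp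
    from exec.WhileFalse[OF this] base show ?case by fastforce
  next
    case (step k)
    then have cond: "bval (Less (var x) (var ''n'')) s" using size by simp
    obtain t s1 where body: "exec c s t s1" "t \<le> T" "I (Suc k) s1" "s1 x 0 = k"
      using body[OF step.hyps(2)] step.prems unfolding triple_def by blast
    define s2 where "s2 = store s1 x 0 (Suc k)"
    have inc: "exec (assign x (Add (var x) (Num 1))) s1 1 s2"
      using exec.Assign[of x "Num 0" "Add (var x) (Num 1)" s1] body(4) by (simp add: s2_def)
    have "I (Suc k) s2" "s2 x 0 = Suc k" using stable[OF body(3)] by (simp_all add: s2_def store_def)
    then obtain u s' where rest: "exec ?W s2 u s'" "u \<le> (n - Suc k) * (T + 2) + 1" "I n s'"
      using step.IH by blast
    have "exec ?W s (Suc (t + 1 + u)) s'"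
      by (rule exec.WhileTrue[OF cond exec.Seq[OF body(1) inc] rest(1)])
    moreover have "n - k = Suc (n - Suc k)" using step.hyps(2) by simp
    then have "Suc (t + 1 + u) \<le> (n - k) * (T + 2) + 1" using rest(2) body(2) by simp
    ultimately show ?case using rest(3) by blast
  qed
  show ?thesis
    unfolding triple_def
  proof (intro allI impI)
    fix s assume "I 0 s"
    define s0 where "s0 = store s x 0 0"
    have "I 0 s0" "s0 x 0 = 0" using stable[OF \<open>I 0 s\<close>] by (simp_all add: s0_def store_def)
    then obtain t s' where w: "exec ?W s0 t s'" "t \<le> n * (T + 2) + 1" "I n s'"
      using while[of 0 s0] by auto
    have "exec (assign x (Num 0)) s 1 s0"
      using exec.Assign[of x "Num 0" "Num 0" s] by (simp add: s0_def)
    from exec.Seq[OF this w(1)] w(2,3)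
    show "\<exists>t s'. exec (count_loop x c) s t s' \<and> t \<le> loop_time n T \<and> I n s'"
      unfolding count_loop_def loop_time_def by fastforce
  qed
qed

text \<open>
  The frame condition: only the arrays named in M may have changed.
\<close>

definition same_outside :: "vname set \<Rightarrow> state \<Rightarrow> state \<Rightarrow> bool" where
  "same_outside M s0 s \<longleftrightarrow> (\<forall>x. x \<notin> M \<longrightarrow> s x = s0 x)"

lemma same_outside_store [simp]:
  "x \<in> M \<Longrightarrow> same_outside M s0 (store s x i v) \<longleftrightarrow> same_outside M s0 s"
  by (auto simp: same_outside_def store_def)

lemma same_outsideD: "same_outside M s0 s \<Longrightarrow> x \<notin> M \<Longrightarrow> s x = s0 x"
  by (simp add: same_outside_def)

lemma same_outside_refl [simp]: "same_outside M s s"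
  by (simp add: same_outside_def)

lemma same_outside_trans:
  "same_outside M s0 s1 \<Longrightarrow> same_outside N s1 s2 \<Longrightarrow> N \<subseteq> M \<Longrightarrow> same_outside M s0 s2"
  unfolding same_outside_def by (metis subsetD)

lemma store_apply [simp]: "store s x i v y = (if y = x then (s x)(i := v) else s y)"
  by (simp add: store_def)

section \<open>The smallest-last colouring program\<close>

text \<open>
  Without multiplication, the row offsets of the adjacency matrix are tabulated by repeated
  addition.
\<close>

definition row_body :: com where
  "row_body = Assign ''row'' (Add (var ''v'') (Num 1)) (Add (Get ''row'' (var ''v'')) (var ''n''))"

definition degree_body :: com where
  "degree_body = Cond (Conj (Less (Num 0) (Get ''adj'' (Add (Get ''row'' (var ''v'')) (var ''w''))))
       (Less (Get ''gone'' (var ''w'')) (Num 1)))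
     (assign ''deg'' (Add (var ''deg'') (Num 1))) Skip"

definition update_best :: com where
  "update_best = Cond (Conj (Less (Get ''gone'' (var ''v'')) (Num 1)) (Less (var ''deg'') (var ''bestdeg'')))
     (Seq (assign ''best'' (var ''v'')) (assign ''bestdeg'' (var ''deg''))) Skip"

definition select_body :: com where
  "select_body = Seq (assign ''deg'' (Num 0)) (Seq (count_loop ''w'' degree_body) update_best)"

definition peel_body :: com where
  "peel_body = Seq (assign ''bestdeg'' (Add (var ''n'') (Num 1)))
     (Seq (count_loop ''v'' select_body)
       (Seq (Assign ''gone'' (var ''best'') (Num 1)) (Assign ''order'' (var ''r'') (var ''best''))))"

text \<open>
  Colours in the neighbourhood of v are stamped with r + 1 in round r. Stamps grow from round to
  round, so the array of stamps is never cleared. Uncoloured neighbours have colour 0 and only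
  stamp the cell 0, which is not inspected.
\<close>

definition mark_body :: com where
  "mark_body = Cond (Less (Num 0) (Get ''adj'' (Add (Get ''row'' (var ''v'')) (var ''w''))))
     (Assign ''used'' (Get ''col'' (var ''w'')) (Add (var ''r'') (Num 1))) Skip"

text \<open>
  Iterated n times, this moves c from 1 to the smallest colour without a current stamp.
\<close>

definition advance_body :: com where
  "advance_body = Cond (Less (var ''r'') (Get ''used'' (var ''c'')))
     (assign ''c'' (Add (var ''c'') (Num 1))) Skip"

text \<open>
  The vertices are coloured in the reverse order of their removal. The second loop only counts the
  attempts to increase c.
\<close>

definition color_body :: com where
  "color_body = Seq (assign ''v'' (Get ''order'' (Sub (Sub (var ''n'') (Num 1)) (var ''r''))))
     (Seq (count_loop ''w'' mark_body)
       (Seq (assign ''c'' (Num 1))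
         (Seq (count_loop ''w'' advance_body) (Assign ''col'' (var ''v'') (var ''c'')))))"

definition coloring_program :: com where
  "coloring_program = Seq (count_loop ''v'' row_body)
     (Seq (count_loop ''r'' peel_body) (count_loop ''r'' color_body))"

definition select_time :: "nat \<Rightarrow> nat" where
  "select_time n = (size (assign ''deg'' (Num 0)) + 1) +
     (loop_time n (size degree_body + 1) + (size update_best + 1))"

definition peel_time :: "nat \<Rightarrow> nat" where
  "peel_time n = (size (assign ''bestdeg'' (Add (var ''n'') (Num 1))) + 1) +
     (loop_time n (select_time n) +
     (size (Seq (Assign ''gone'' (var ''best'') (Num 1)) (Assign ''order'' (var ''r'') (var ''best''))) + 1))"

definition color_time :: "nat \<Rightarrow> nat" where
  "color_time n = (size (assign ''v'' (Get ''order'' (Sub (Sub (var ''n'') (Num 1)) (var ''r'')))) + 1) +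
     (loop_time n (size mark_body + 1) + ((size (assign ''c'' (Num 1)) + 1) +
     (loop_time n (size advance_body + 1) + (size (Assign ''col'' (var ''v'') (var ''c'')) + 1))))"

definition program_time :: "nat \<Rightarrow> nat" where
  "program_time n = loop_time n (size row_body + 1) + (loop_time n (peel_time n) + loop_time n (color_time n))"

text \<open>
  The graph as the program sees it, on the vertices 0, ..., n - 1.
\<close>

locale degenerate_graph =
  fixes n :: nat and E :: "nat \<Rightarrow> nat \<Rightarrow> bool" and D :: nat
  assumes E_sym: "E u v \<Longrightarrow> E v u" and E_irrefl: "\<not> E v v"
    and degenerate: "X \<subseteq> {..<n} \<Longrightarrow> X \<noteq> {} \<Longrightarrow> \<exists>v\<in>X. card {w \<in> X. E v w} \<le> D"
begin

definition represents :: "state \<Rightarrow> bool" where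
  "represents s \<longleftrightarrow> s ''n'' 0 = n \<and> (\<forall>v<n. s ''row'' v = v * n) \<and>
     (\<forall>v<n. \<forall>w<n. s ''adj'' (v * n + w) = (if E v w then 1 else 0))"

lemma row_loop:
  assumes "s0 ''n'' 0 = n" "\<And>v w. v < n \<Longrightarrow> w < n \<Longrightarrow> s0 ''adj'' (v * n + w) = (if E v w then 1 else 0)"
    "s0 ''row'' 0 = 0"
  shows "triple (\<lambda>s. s = s0) (loop_time n (size row_body + 1)) (count_loop ''v'' row_body)
    (\<lambda>s. same_outside {''v'', ''row''} s0 s \<and> represents s)"
proof -
  define I where "I k s \<longleftrightarrow> same_outside {''v'', ''row''} s0 s \<and> (\<forall>v\<le>k. s ''row'' v = v * n)" for k s
  have "triple (I 0) (loop_time n (size row_body + 1)) (count_loop ''v'' row_body) (I n)"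
  proof (rule triple_count_loop)
    fix k s assume "I k s" then show "s ''n'' 0 = n" using assms(1) by (simp add: I_def same_outside_def)
  next
    fix k s v assume "I k s" then show "I k (store s ''v'' 0 v)" by (simp add: I_def)
  next
    fix k assume "k < n"
    show "triple (\<lambda>s. I k s \<and> s ''v'' 0 = k) (size row_body + 1) row_body (\<lambda>s. I (Suc k) s \<and> s ''v'' 0 = k)"
      by (rule triple_loop_free)
        (use assms(1) in \<open>auto simp: row_body_def I_def same_outside_def store_def le_Suc_eq\<close>)
  qed
  then show ?thesis
    by (rule triple_conseq) (use assms in \<open>auto simp: I_def same_outside_def represents_def\<close>)
qed

lemma degree_loop:
  assumes "represents s0" "v < n" "s0 ''v'' 0 = v" "s0 ''deg'' 0 = 0"
  shows "triple (\<lambda>s. s = s0) (loop_time n (size degree_body + 1)) (count_loop ''w'' degree_body)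
    (\<lambda>s. same_outside {''w'', ''deg''} s0 s \<and> s ''deg'' 0 = card {w. w < n \<and> s0 ''gone'' w = 0 \<and> E v w})"
proof -
  define I where "I k s \<longleftrightarrow> same_outside {''w'', ''deg''} s0 s \<and>
    s ''deg'' 0 = card {w. w < k \<and> s0 ''gone'' w = 0 \<and> E v w}" for k s
  have "triple (I 0) (loop_time n (size degree_body + 1)) (count_loop ''w'' degree_body) (I n)"
  proof (rule triple_count_loop)
    fix k s assume "I k s"
    then show "s ''n'' 0 = n" using assms(1) by (simp add: I_def same_outside_def represents_def)
  next
    fix k s v assume "I k s" then show "I k (store s ''w'' 0 v)" by (simp add: I_def)
  next
    fix k assume k: "k < n"
    have new: "card {w. w < Suc k \<and> s0 ''gone'' w = 0 \<and> E v w} =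
      card {w. w < k \<and> s0 ''gone'' w = 0 \<and> E v w} + (if s0 ''gone'' k = 0 \<and> E v k then 1 else 0)"
    proof -
      have "{w. w < Suc k \<and> s0 ''gone'' w = 0 \<and> E v w} =
        (if s0 ''gone'' k = 0 \<and> E v k then insert k else id) {w. w < k \<and> s0 ''gone'' w = 0 \<and> E v w}"
        by (auto simp: less_Suc_eq)
      then show ?thesis by simp
    qed
    show "triple (\<lambda>s. I k s \<and> s ''w'' 0 = k) (size degree_body + 1) degree_body (\<lambda>s. I (Suc k) s \<and> s ''w'' 0 = k)"
    proof (rule triple_loop_free)
      fix s assume s: "I k s \<and> s ''w'' 0 = k"
      then have "s ''v'' 0 = v" "s ''row'' v = v * n" "s ''adj'' (v * n + k) = (if E v k then 1 else 0)"
        "s ''gone'' k = s0 ''gone'' k"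
        using assms k by (simp_all add: I_def same_outside_def represents_def)
      with s show "I (Suc k) (effect degree_body s) \<and> effect degree_body s ''w'' 0 = k"
        unfolding I_def new by (auto simp: degree_body_def same_outside_def store_def)
    qed (simp add: degree_body_def)
  qed
  then show ?thesis
    by (rule triple_conseq) (use assms in \<open>auto simp: I_def same_outside_def\<close>)
qed

lemma represents_same_outside:
  assumes "represents s0" "same_outside M s0 s" "''n'' \<notin> M" "''row'' \<notin> M" "''adj'' \<notin> M"
  shows "represents s"
  using assms by (simp add: represents_def same_outside_def)

text \<open>
  A is the set of vertices that have not been removed yet.
\<close>

definition rest_degree :: "(nat \<Rightarrow> bool) \<Rightarrow> nat \<Rightarrow> nat" where
  "rest_degree A v = card {w. w < n \<and> A w \<and> E v w}"

lemma exists_low_rest_degree: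
  assumes "v < n" "A v"
  shows "\<exists>v<n. A v \<and> rest_degree A v \<le> D"
proof -
  have "\<exists>v\<in>{v. v < n \<and> A v}. card {w \<in> {v. v < n \<and> A v}. E v w} \<le> D"
    using assms by (intro degenerate) auto
  then show ?thesis by (simp add: rest_degree_def conj_assoc)
qed

text \<open>
  Some remaining vertex has at most D remaining neighbours, hence so has the one of minimum degree,
  although D is unknown to the program.
\<close>

lemma select_loop:
  assumes rep: "represents s0" and init: "s0 ''bestdeg'' 0 = n + 1"
    and alive: "v0 < n" "s0 ''gone'' v0 = 0"
  defines "A \<equiv> \<lambda>v. s0 ''gone'' v = 0"
  shows "triple (\<lambda>s. s = s0) (loop_time n (select_time n)) (count_loop ''v'' select_body)
    (\<lambda>s. same_outside {''v'', ''w'', ''deg'', ''best'', ''bestdeg''} s0 s \<and>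
       s ''best'' 0 < n \<and> A (s ''best'' 0) \<and> rest_degree A (s ''best'' 0) \<le> D)"
proof -
  \<comment> \<open>The value n + 1 exceeds all degrees and stands for the absence of a candidate.\<close>
  define I where "I k s \<longleftrightarrow> same_outside {''v'', ''w'', ''deg'', ''best'', ''bestdeg''} s0 s \<and>
    (\<forall>v<k. A v \<longrightarrow> s ''bestdeg'' 0 \<le> rest_degree A v) \<and>
    (s ''bestdeg'' 0 = n + 1 \<or>
      s ''best'' 0 < n \<and> A (s ''best'' 0) \<and> s ''bestdeg'' 0 = rest_degree A (s ''best'' 0))" for k s
  have "triple (I 0) (loop_time n (select_time n)) (count_loop ''v'' select_body) (I n)"
  proof (rule triple_count_loop)
    fix k s assume "I k s"
    then show "s ''n'' 0 = n" using rep by (simp add: I_def same_outside_def represents_def)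
  next
    fix k s v assume "I k s" then show "I k (store s ''v'' 0 v)" by (simp add: I_def)
  next
    fix k assume k: "k < n"
    show "triple (\<lambda>s. I k s \<and> s ''v'' 0 = k) (select_time n) select_body (\<lambda>s. I (Suc k) s \<and> s ''v'' 0 = k)"
      unfolding select_body_def select_time_def
    proof (rule triple_seq[OF triple_loop_free triple_seq[OF triple_pointwise triple_loop_free]])
      let ?P = "\<lambda>s. I k s \<and> s ''v'' 0 = k \<and> s ''deg'' 0 = 0"
      fix s assume "I k s \<and> s ''v'' 0 = k"
      then show "?P (effect (assign ''deg'' (Num 0)) s)" by (simp add: I_def)
    next
      let ?R = "\<lambda>s. I k s \<and> s ''v'' 0 = k \<and> s ''deg'' 0 = rest_degree A k"
      fix s1 assume s1: "I k s1 \<and> s1 ''v'' 0 = k \<and> s1 ''deg'' 0 = 0"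
      then have "represents s1"
        by (intro represents_same_outside[OF rep, of "{''v'', ''w'', ''deg'', ''best'', ''bestdeg''}"]) (auto simp: I_def)
      from degree_loop[OF this k] s1
      have "triple (\<lambda>s. s = s1) (loop_time n (size degree_body + 1)) (count_loop ''w'' degree_body)
        (\<lambda>s. same_outside {''w'', ''deg''} s1 s \<and> s ''deg'' 0 = card {w. w < n \<and> s1 ''gone'' w = 0 \<and> E k w})"
        by simp
      then show "triple (\<lambda>s. s = s1) (loop_time n (size degree_body + 1)) (count_loop ''w'' degree_body) ?R"
      proof (rule triple_conseq)
        fix s assume "same_outside {''w'', ''deg''} s1 s \<and>
          s ''deg'' 0 = card {w. w < n \<and> s1 ''gone'' w = 0 \<and> E k w}"
        then have s: "same_outside {''w'', ''deg''} s1 s"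
          and deg: "s ''deg'' 0 = card {w. w < n \<and> s1 ''gone'' w = 0 \<and> E k w}" by simp_all
        have so: "same_outside {''v'', ''w'', ''deg'', ''best'', ''bestdeg''} s0 s1" using s1 by (simp add: I_def)
        have "s1 ''gone'' = s0 ''gone''" by (rule same_outsideD[OF so]) simp
        then have "s ''deg'' 0 = rest_degree A k" using deg by (simp add: rest_degree_def A_def)
        moreover have "same_outside {''v'', ''w'', ''deg'', ''best'', ''bestdeg''} s0 s"
          using s1 s by (auto simp: I_def elim: same_outside_trans)
        ultimately show "?R s" using s1 same_outsideD[OF s] by (simp add: I_def)
      qed
    next
      fix s assume s: "I k s \<and> s ''v'' 0 = k \<and> s ''deg'' 0 = rest_degree A k"
      have so: "same_outside {''v'', ''w'', ''deg'', ''best'', ''bestdeg''} s0 s" using s by (simp add: I_def)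
      have "s ''gone'' = s0 ''gone''" by (rule same_outsideD[OF so]) simp
      then have eff: "effect update_best s = (if A k \<and> rest_degree A k < s ''bestdeg'' 0
          then store (store s ''best'' 0 k) ''bestdeg'' 0 (rest_degree A k) else s)"
        using s by (simp add: update_best_def A_def)
      show "I (Suc k) (effect update_best s) \<and> effect update_best s ''v'' 0 = k"
      proof (cases "A k \<and> rest_degree A k < s ''bestdeg'' 0")
        case True
        have "rest_degree A k \<le> rest_degree A v" if "v < Suc k" "A v" for v
          using that True s less_Suc_eq[of v k] by (auto simp: I_def intro: order_trans less_imp_le)
        then show ?thesis using True s k unfolding eff by (simp add: I_def)
      next
        case False
        then have "s ''bestdeg'' 0 \<le> rest_degree A v" if "v < Suc k" "A v" for v
          using that s less_Suc_eq[of v k] by (auto simp: I_def)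
        moreover have "effect update_best s = s" unfolding eff using False by (rule if_not_P)
        ultimately show ?thesis using s by (simp add: I_def)
      qed
    qed (simp_all add: update_best_def)
  qed
  then show ?thesis
  proof (rule triple_conseq)
    fix s assume "s = s0"
    then show "I 0 s" using init by (simp add: I_def same_outside_def)
  next
    fix s assume s: "I n s"
    obtain v where v: "v < n" "A v" "rest_degree A v \<le> D"
      using exists_low_rest_degree[of v0 A] alive by (auto simp: A_def)
    have le: "s ''bestdeg'' 0 \<le> rest_degree A v" using s v by (simp add: I_def)
    have "rest_degree A v \<le> card {..<n}" unfolding rest_degree_def by (rule card_mono) auto
    with le have "s ''bestdeg'' 0 \<noteq> n + 1" by simp
    with s le v(3) show "same_outside {''v'', ''w'', ''deg'', ''best'', ''bestdeg''} s0 s \<and>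
       s ''best'' 0 < n \<and> A (s ''best'' 0) \<and> rest_degree A (s ''best'' 0) \<le> D"
      by (auto simp: I_def)
  qed
qed

text \<open>
  The first r steps of an elimination order: each vertex has at most D neighbours among those that
  come after it.
\<close>

definition peeling :: "nat \<Rightarrow> (nat \<Rightarrow> nat) \<Rightarrow> bool" where
  "peeling r ord \<longleftrightarrow> inj_on ord {..<r} \<and> ord ` {..<r} \<subseteq> {..<n} \<and>
     (\<forall>i<r. rest_degree (\<lambda>w. w \<notin> ord ` {..<i}) (ord i) \<le> D)"

lemma peeling_Suc:
  assumes "peeling r ord" "b < n" "b \<notin> ord ` {..<r}" "rest_degree (\<lambda>w. w \<notin> ord ` {..<r}) b \<le> D"
  shows "peeling (Suc r) (ord(r := b))"
proof -
  have img: "(ord(r := b)) ` {..<i} = ord ` {..<i}" if "i \<le> r" for i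
    using that by (auto simp: image_iff)
  have "inj_on (ord(r := b)) {..<Suc r}"
    using assms(1,3) by (auto simp: peeling_def inj_on_def lessThan_Suc image_iff)
  moreover have "(ord(r := b)) ` {..<Suc r} \<subseteq> {..<n}"
    using assms(1,2) by (auto simp: peeling_def lessThan_Suc)
  moreover have "rest_degree (\<lambda>w. w \<notin> (ord(r := b)) ` {..<i}) ((ord(r := b)) i) \<le> D" if "i < Suc r" for i
    using that assms(1,4) img[of i] by (cases "i = r") (auto simp: peeling_def simp del: fun_upd_apply image_iff, simp_all)
  ultimately show ?thesis unfolding peeling_def by blast
qed

lemma peel_loop:
  assumes rep: "represents s0" and gone0: "\<And>v. s0 ''gone'' v = 0"
  shows "triple (\<lambda>s. s = s0) (loop_time n (peel_time n)) (count_loop ''r'' peel_body)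
    (\<lambda>s. same_outside {''v'', ''w'', ''r'', ''deg'', ''best'', ''bestdeg'', ''gone'', ''order''} s0 s \<and>
       peeling n (s ''order''))"
proof -
  define M where "M = {''v'', ''w'', ''r'', ''deg'', ''best'', ''bestdeg'', ''gone'', ''order''}"
  define I where "I r s \<longleftrightarrow> same_outside M s0 s \<and> peeling r (s ''order'') \<and>
    (\<forall>v<n. s ''gone'' v = 0 \<longleftrightarrow> v \<notin> s ''order'' ` {..<r})" for r s
  have "triple (I 0) (loop_time n (peel_time n)) (count_loop ''r'' peel_body) (I n)"
  proof (rule triple_count_loop)
    fix k s assume "I k s"
    then show "s ''n'' 0 = n" using rep by (simp add: I_def same_outside_def represents_def M_def)
  next
    fix k s v assume "I k s" then show "I k (store s ''r'' 0 v)" by (simp add: I_def M_def)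
  next
    fix r assume r: "r < n"
    show "triple (\<lambda>s. I r s \<and> s ''r'' 0 = r) (peel_time n) peel_body (\<lambda>s. I (Suc r) s \<and> s ''r'' 0 = r)"
      unfolding peel_body_def peel_time_def
    proof (rule triple_seq[OF triple_loop_free triple_seq[OF triple_pointwise triple_loop_free]])
      let ?P = "\<lambda>s. I r s \<and> s ''r'' 0 = r \<and> s ''bestdeg'' 0 = n + 1"
      fix s assume s: "I r s \<and> s ''r'' 0 = r"
      then have "s ''n'' = s0 ''n''" by (intro same_outsideD[of M]) (simp_all add: I_def M_def)
      then show "?P (effect (assign ''bestdeg'' (Add (var ''n'') (Num 1))) s)"
        using rep s by (simp add: I_def M_def represents_def)
    next
      let ?R = "\<lambda>s. I r s \<and> s ''r'' 0 = r \<and> s ''best'' 0 < n \<and> s ''best'' 0 \<notin> s ''order'' ` {..<r} \<and>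
        rest_degree (\<lambda>w. w \<notin> s ''order'' ` {..<r}) (s ''best'' 0) \<le> D"
      fix s1 assume s1: "I r s1 \<and> s1 ''r'' 0 = r \<and> s1 ''bestdeg'' 0 = n + 1"
      then have rep1: "represents s1"
        by (intro represents_same_outside[OF rep, of M]) (auto simp: I_def M_def)
      have "card (s1 ''order'' ` {..<r}) < card {..<n}"
        using card_image_le[of "{..<r}" "s1 ''order''"] r by simp
      then have "\<not> {..<n} \<subseteq> s1 ''order'' ` {..<r}"
        using card_mono[of "s1 ''order'' ` {..<r}" "{..<n}"] by auto
      then obtain v0 where "v0 < n" "s1 ''gone'' v0 = 0" using s1 by (auto simp: I_def)
      note sel = select_loop[OF rep1 _ this]
      have gone: "rest_degree (\<lambda>v. s1 ''gone'' v = 0) = rest_degree (\<lambda>w. w \<notin> s1 ''order'' ` {..<r})"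
        using s1 by (auto simp: rest_degree_def I_def fun_eq_iff intro!: arg_cong[of _ _ card])
      show "triple (\<lambda>s. s = s1) (loop_time n (select_time n)) (count_loop ''v'' select_body) ?R"
      proof (rule triple_conseq[OF sel])
        show "s1 ''bestdeg'' 0 = n + 1" using s1 by simp
        fix s assume "same_outside {''v'', ''w'', ''deg'', ''best'', ''bestdeg''} s1 s \<and> s ''best'' 0 < n \<and>
          s1 ''gone'' (s ''best'' 0) = 0 \<and> rest_degree (\<lambda>v. s1 ''gone'' v = 0) (s ''best'' 0) \<le> D"
        then have s: "same_outside {''v'', ''w'', ''deg'', ''best'', ''bestdeg''} s1 s" and best: "s ''best'' 0 < n"
          "s1 ''gone'' (s ''best'' 0) = 0" "rest_degree (\<lambda>v. s1 ''gone'' v = 0) (s ''best'' 0) \<le> D" by simp_all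
        have "same_outside M s0 s"
          by (rule same_outside_trans[OF _ s]) (use s1 in \<open>simp_all add: I_def M_def\<close>)
        then show "?R s" using s1 best same_outsideD[OF s] gone by (simp add: I_def)
      qed simp
    next
      let ?c = "Seq (Assign ''gone'' (var ''best'') (Num 1)) (Assign ''order'' (var ''r'') (var ''best''))"
      fix s assume s: "I r s \<and> s ''r'' 0 = r \<and> s ''best'' 0 < n \<and> s ''best'' 0 \<notin> s ''order'' ` {..<r} \<and>
        rest_degree (\<lambda>w. w \<notin> s ''order'' ` {..<r}) (s ''best'' 0) \<le> D"
      let ?ord = "(s ''order'')(r := s ''best'' 0)"
      have "peeling (Suc r) ?ord" using s by (intro peeling_Suc) (auto simp: I_def)
      moreover have "?ord ` {..<Suc r} = insert (s ''best'' 0) (s ''order'' ` {..<r})"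
        by (auto simp: lessThan_Suc image_iff)
      ultimately show "I (Suc r) (effect ?c s) \<and> effect ?c s ''r'' 0 = r"
        using s by (simp add: I_def M_def)
    qed simp_all
  qed
  then show ?thesis
    by (rule triple_conseq) (use gone0 in \<open>simp_all add: I_def M_def peeling_def\<close>)
qed

lemma mark_loop:
  assumes rep: "represents s0" and v: "v < n" "s0 ''v'' 0 = v" and r: "s0 ''r'' 0 = r"
  shows "triple (\<lambda>s. s = s0) (loop_time n (size mark_body + 1)) (count_loop ''w'' mark_body)
    (\<lambda>s. same_outside {''w'', ''used''} s0 s \<and>
       (\<forall>x. s ''used'' x = (if \<exists>w<n. E v w \<and> s0 ''col'' w = x then r + 1 else s0 ''used'' x)))"
proof -
  define I where "I k s \<longleftrightarrow> same_outside {''w'', ''used''} s0 s \<and>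
    (\<forall>x. s ''used'' x = (if \<exists>w<k. E v w \<and> s0 ''col'' w = x then r + 1 else s0 ''used'' x))" for k s
  have "triple (I 0) (loop_time n (size mark_body + 1)) (count_loop ''w'' mark_body) (I n)"
  proof (rule triple_count_loop)
    fix k s assume "I k s"
    then have "s ''n'' = s0 ''n''" by (intro same_outsideD[of "{''w'', ''used''}"]) (simp_all add: I_def)
    then show "s ''n'' 0 = n" using rep by (simp add: represents_def)
  next
    fix k s v assume "I k s" then show "I k (store s ''w'' 0 v)" by (simp add: I_def)
  next
    fix k assume k: "k < n"
    show "triple (\<lambda>s. I k s \<and> s ''w'' 0 = k) (size mark_body + 1) mark_body (\<lambda>s. I (Suc k) s \<and> s ''w'' 0 = k)"
    proof (rule triple_loop_free)
      fix s assume s: "I k s \<and> s ''w'' 0 = k"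
      then have so: "same_outside {''w'', ''used''} s0 s" by (simp add: I_def)
      have eqs: "s ''v'' = s0 ''v''" "s ''r'' = s0 ''r''" "s ''col'' = s0 ''col''"
        "s ''row'' = s0 ''row''" "s ''adj'' = s0 ''adj''"
        by (rule same_outsideD[OF so]; simp)+
      have eff: "effect mark_body s = (if E v k then store s ''used'' (s0 ''col'' k) (r + 1) else s)"
        using s k rep v r by (simp add: mark_body_def eqs represents_def)
      show "I (Suc k) (effect mark_body s) \<and> effect mark_body s ''w'' 0 = k"
        using s unfolding eff by (auto simp: I_def less_Suc_eq)
    qed (simp add: mark_body_def)
  qed
  then show ?thesis
    by (rule triple_conseq) (simp_all add: I_def)
qed

lemma advance_loop:
  assumes rep: "represents s0" and c: "s0 ''c'' 0 = 1" and r: "s0 ''r'' 0 = r"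
  shows "triple (\<lambda>s. s = s0) (loop_time n (size advance_body + 1)) (count_loop ''w'' advance_body)
    (\<lambda>s. same_outside {''w'', ''c''} s0 s \<and> 1 \<le> s ''c'' 0 \<and>
       (\<forall>x. 1 \<le> x \<and> x < s ''c'' 0 \<longrightarrow> r < s0 ''used'' x) \<and>
       (r < s0 ''used'' (s ''c'' 0) \<longrightarrow> s ''c'' 0 = n + 1))"
proof -
  define I where "I k s \<longleftrightarrow> same_outside {''w'', ''c''} s0 s \<and> 1 \<le> s ''c'' 0 \<and>
       (\<forall>x. 1 \<le> x \<and> x < s ''c'' 0 \<longrightarrow> r < s0 ''used'' x) \<and>
       (r < s0 ''used'' (s ''c'' 0) \<longrightarrow> s ''c'' 0 = k + 1)" for k s
  have "triple (I 0) (loop_time n (size advance_body + 1)) (count_loop ''w'' advance_body) (I n)"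
  proof (rule triple_count_loop)
    fix k s assume "I k s"
    then have "s ''n'' = s0 ''n''" by (intro same_outsideD[of "{''w'', ''c''}"]) (simp_all add: I_def)
    then show "s ''n'' 0 = n" using rep by (simp add: represents_def)
  next
    fix k s v assume "I k s" then show "I k (store s ''w'' 0 v)" by (simp add: I_def)
  next
    fix k assume k: "k < n"
    show "triple (\<lambda>s. I k s \<and> s ''w'' 0 = k) (size advance_body + 1) advance_body (\<lambda>s. I (Suc k) s \<and> s ''w'' 0 = k)"
    proof (rule triple_loop_free)
      fix s assume s: "I k s \<and> s ''w'' 0 = k"
      then have so: "same_outside {''w'', ''c''} s0 s" by (simp add: I_def)
      have eqs: "s ''r'' = s0 ''r''" "s ''used'' = s0 ''used''"
        by (rule same_outsideD[OF so]; simp)+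
      have eff: "effect advance_body s =
        (if r < s0 ''used'' (s ''c'' 0) then store s ''c'' 0 (s ''c'' 0 + 1) else s)"
        using r by (simp add: advance_body_def eqs)
      show "I (Suc k) (effect advance_body s) \<and> effect advance_body s ''w'' 0 = k"
        using s unfolding eff by (auto simp: I_def less_Suc_eq)
    qed (simp add: advance_body_def)
  qed
  then show ?thesis
    by (rule triple_conseq) (use c in \<open>simp_all add: I_def\<close>)
qed

text \<open>
  Colour 0 marks the vertices outside S as uncoloured.
\<close>

definition partial_coloring :: "nat set \<Rightarrow> (nat \<Rightarrow> nat) \<Rightarrow> bool" where
  "partial_coloring S col \<longleftrightarrow> (\<forall>v\<in>S. 1 \<le> col v \<and> col v \<le> D + 1) \<and> (\<forall>v. v < n \<and> v \<notin> S \<longrightarrow> col v = 0) \<and>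
     (\<forall>u\<in>S. \<forall>v\<in>S. E u v \<longrightarrow> col u \<noteq> col v)"

text \<open>
  All colours below c occur among the neighbours of v in S, so c - 1 is at most their number. This
  number is at most D, and it is less than n, so the search for a colour has not run out of rounds.
\<close>

lemma partial_coloring_insert:
  assumes S: "partial_coloring S col" "S \<subseteq> {..<n}" "v < n" "v \<notin> S"
    and degree: "card {w \<in> S. E v w} \<le> D"
    and c: "1 \<le> c" "\<And>x. 1 \<le> x \<Longrightarrow> x < c \<Longrightarrow> \<exists>w<n. E v w \<and> col w = x"
      "\<exists>w<n. E v w \<and> col w = c \<Longrightarrow> c = n + 1"
  shows "partial_coloring (insert v S) (col(v := c))"
proof -
  have used: "w \<in> S" if "w < n" "col w \<ge> 1" for w
    using that S(1) by (force simp: partial_coloring_def)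
  have fin: "finite {w \<in> S. E v w}" using S(2) by (auto intro: finite_subset[of _ "{..<n}"])
  have "{1..<c} \<subseteq> col ` {w \<in> S. E v w}"
  proof
    fix x assume "x \<in> {1..<c}"
    then obtain w where "w < n" "E v w" "col w = x" "1 \<le> x" using c(2)[of x] by auto
    then show "x \<in> col ` {w \<in> S. E v w}" using used[of w] by auto
  qed
  then have "card {1..<c} \<le> card (col ` {w \<in> S. E v w})" using fin by (intro card_mono) auto
  also have "\<dots> \<le> card {w \<in> S. E v w}" using fin by (rule card_image_le)
  finally have le: "c - 1 \<le> card {w \<in> S. E v w}" by simp
  have "card {w \<in> S. E v w} < card {..<n}"
    using S(2,3) E_irrefl by (intro psubset_card_mono) auto
  with le have "c \<noteq> n + 1" by simp
  then have "col w \<noteq> c" if "w \<in> S" "E v w" for w using c(3) that S(2) by blast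
  moreover have "col w \<noteq> c" if "w \<in> S" "E w v" for w using calculation that E_sym by blast
  moreover have "c \<le> D + 1" using le degree by linarith
  ultimately show ?thesis
    using S(1,4) c(1) E_irrefl by (auto simp: partial_coloring_def)
qed

text \<open>
  The vertices are coloured from the end of the elimination order. When v gets its colour, the
  coloured vertices are exactly those that come after v, and at most D of them are neighbours of v.
\<close>

lemma color_loop:
  assumes rep: "represents s0" and zero: "\<And>x. s0 ''col'' x = 0" "\<And>x. s0 ''used'' x = 0"
    and ord: "peeling n (s0 ''order'')"
  shows "triple (\<lambda>s. s = s0) (loop_time n (color_time n)) (count_loop ''r'' color_body)
    (\<lambda>s. partial_coloring {..<n} (s ''col''))"
proof -
  define M where "M = {''v'', ''w'', ''r'', ''c'', ''used'', ''col''}"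
  let ?ord = "s0 ''order''"
  have inj: "inj_on ?ord {..<n}" and img: "?ord ` {..<n} \<subseteq> {..<n}"
    and low: "\<And>i. i < n \<Longrightarrow> rest_degree (\<lambda>w. w \<notin> ?ord ` {..<i}) (?ord i) \<le> D"
    using ord by (auto simp: peeling_def)
  have onto: "?ord ` {..<n} = {..<n}"
    by (rule card_subset_eq) (use inj img in \<open>simp_all add: card_image\<close>)
  define S where "S r = ?ord ` {n - r..<n}" for r
  define I where "I r s \<longleftrightarrow> same_outside M s0 s \<and> partial_coloring (S r) (s ''col'') \<and>
    (\<forall>x. s ''used'' x \<le> r)" for r s
  have "triple (I 0) (loop_time n (color_time n)) (count_loop ''r'' color_body) (I n)"
  proof (rule triple_count_loop)
    fix k s assume "I k s"
    then have "s ''n'' = s0 ''n''" by (intro same_outsideD[of M]) (simp_all add: I_def M_def)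
    then show "s ''n'' 0 = n" using rep by (simp add: represents_def)
  next
    fix k s v assume "I k s" then show "I k (store s ''r'' 0 v)" by (simp add: I_def M_def)
  next
    fix r assume r: "r < n"
    define v where "v = ?ord (n - 1 - r)"
    have "v \<in> ?ord ` {..<n}" unfolding v_def using r by (intro imageI) simp
    then have v: "v < n" using img by blast
    have "S r \<subseteq> ?ord ` {..<n}" unfolding S_def by (rule image_mono) auto
    then have sub: "S r \<subseteq> {..<n}" using img by (rule order_trans)
    have disj: "?ord ` {..<n - 1 - r} \<inter> S r = {}"
    proof -
      have "?ord ` ({..<n - 1 - r} \<inter> {n - r..<n}) = ?ord ` {..<n - 1 - r} \<inter> S r"
        unfolding S_def by (rule inj_on_image_Int[OF inj]) auto
      moreover have "{..<n - 1 - r} \<inter> {n - r..<n} = {}" by auto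
      ultimately show ?thesis by simp
    qed
    have vS: "v \<notin> S r"
    proof
      assume "v \<in> S r"
      then have "?ord (n - 1 - r) \<in> ?ord ` {n - r..<n}" by (simp only: S_def v_def)
      then obtain i where i: "?ord (n - 1 - r) = ?ord i" "i \<in> {n - r..<n}" by (rule imageE)
      have "n - 1 - r \<in> {..<n}" "i \<in> {..<n}" using i(2) r by simp_all
      then have "n - 1 - r = i" by (rule inj_onD[OF inj, OF i(1)])
      moreover have "n - r \<le> i" using i(2) by simp
      ultimately show False using r by linarith
    qed
    have "{n - Suc r..<n} = insert (n - 1 - r) {n - r..<n}" using r by auto
    then have S_Suc: "S (Suc r) = insert v (S r)" by (simp add: S_def v_def)
    have "card {w \<in> S r. E v w} \<le> rest_degree (\<lambda>w. w \<notin> ?ord ` {..<n - 1 - r}) v"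
    proof -
      have "{w \<in> S r. E v w} \<subseteq> {w. w < n \<and> w \<notin> ?ord ` {..<n - 1 - r} \<and> E v w}"
        using sub disj by blast
      then show ?thesis unfolding rest_degree_def by (rule card_mono[rotated]) simp
    qed
    also have "\<dots> \<le> D" using low[of "n - 1 - r"] r by (simp add: v_def)
    finally have degree: "card {w \<in> S r. E v w} \<le> D" .
    show "triple (\<lambda>s. I r s \<and> s ''r'' 0 = r) (color_time n) color_body (\<lambda>s. I (Suc r) s \<and> s ''r'' 0 = r)"
      unfolding color_body_def color_time_def
    proof (rule triple_seq[OF triple_loop_free triple_seq[OF triple_pointwise triple_seq[OF triple_loop_free
            triple_seq[OF triple_pointwise triple_loop_free]]]])
      let ?P = "\<lambda>s. I r s \<and> s ''r'' 0 = r \<and> s ''v'' 0 = v"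
      fix s assume s: "I r s \<and> s ''r'' 0 = r"
      then have so: "same_outside M s0 s" by (simp add: I_def)
      have "s ''n'' = s0 ''n''" "s ''order'' = s0 ''order''"
        by (rule same_outsideD[OF so]; simp add: M_def)+
      then show "?P (effect (assign ''v'' (Get ''order'' (Sub (Sub (var ''n'') (Num 1)) (var ''r'')))) s)"
        using rep s by (simp add: I_def M_def v_def represents_def)
    next
      let ?Q = "\<lambda>s. same_outside M s0 s \<and> partial_coloring (S r) (s ''col'') \<and> (\<forall>x. s ''used'' x \<le> Suc r) \<and>
        s ''r'' 0 = r \<and> s ''v'' 0 = v \<and> (\<forall>x. r < s ''used'' x \<longleftrightarrow> (\<exists>w<n. E v w \<and> s ''col'' w = x))"
      fix s1 assume s1: "I r s1 \<and> s1 ''r'' 0 = r \<and> s1 ''v'' 0 = v"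
      then have "represents s1"
        by (intro represents_same_outside[OF rep, of M]) (auto simp: I_def M_def)
      note mark = mark_loop[OF this v, of r]
      show "triple (\<lambda>s. s = s1) (loop_time n (size mark_body + 1)) (count_loop ''w'' mark_body) ?Q"
      proof (rule triple_conseq[OF mark])
        fix s assume "same_outside {''w'', ''used''} s1 s \<and>
          (\<forall>x. s ''used'' x = (if \<exists>w<n. E v w \<and> s1 ''col'' w = x then r + 1 else s1 ''used'' x))"
        then have so: "same_outside {''w'', ''used''} s1 s"
          and used: "\<And>x. s ''used'' x = (if \<exists>w<n. E v w \<and> s1 ''col'' w = x then r + 1 else s1 ''used'' x)"
          by simp_all
        have eqs: "s ''v'' = s1 ''v''" "s ''r'' = s1 ''r''" "s ''col'' = s1 ''col''"
          by (rule same_outsideD[OF so]; simp)+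
        have so': "same_outside M s0 s"
          by (rule same_outside_trans[OF _ so]) (use s1 in \<open>simp_all add: I_def M_def\<close>)
        have "s1 ''used'' x \<le> r" for x using s1 by (simp add: I_def)
        then have "s ''used'' x \<le> Suc r \<and> (r < s ''used'' x \<longleftrightarrow> (\<exists>w<n. E v w \<and> s ''col'' w = x))" for x
          unfolding used eqs by (cases "\<exists>w<n. E v w \<and> s1 ''col'' w = x") (simp_all only: if_True if_False le_SucI not_less simp_thms, simp_all)
        then show "?Q s" using s1 so' by (simp add: I_def eqs)
      qed (use s1 in simp_all)
    next
      let ?Q = "\<lambda>s. same_outside M s0 s \<and> partial_coloring (S r) (s ''col'') \<and> (\<forall>x. s ''used'' x \<le> Suc r) \<and>
        s ''r'' 0 = r \<and> s ''v'' 0 = v \<and> (\<forall>x. r < s ''used'' x \<longleftrightarrow> (\<exists>w<n. E v w \<and> s ''col'' w = x))"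
      let ?R = "\<lambda>s. ?Q s \<and> s ''c'' 0 = 1"
      fix s assume "?Q s"
      then show "?R (effect (assign ''c'' (Num 1)) s)" by (simp add: M_def)
    next
      let ?Q = "\<lambda>s. same_outside M s0 s \<and> partial_coloring (S r) (s ''col'') \<and> (\<forall>x. s ''used'' x \<le> Suc r) \<and>
        s ''r'' 0 = r \<and> s ''v'' 0 = v \<and> (\<forall>x. r < s ''used'' x \<longleftrightarrow> (\<exists>w<n. E v w \<and> s ''col'' w = x))"
      let ?T = "\<lambda>s. same_outside M s0 s \<and> (\<forall>x. s ''used'' x \<le> Suc r) \<and> s ''r'' 0 = r \<and> s ''v'' 0 = v \<and>
        partial_coloring (insert v (S r)) ((s ''col'')(v := s ''c'' 0))"
      fix s1 assume s1: "?Q s1 \<and> s1 ''c'' 0 = 1"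
      then have "represents s1"
        by (intro represents_same_outside[OF rep, of M]) (auto simp: M_def)
      note advance = advance_loop[OF this, of r]
      show "triple (\<lambda>s. s = s1) (loop_time n (size advance_body + 1)) (count_loop ''w'' advance_body) ?T"
      proof (rule triple_conseq[OF advance])
        fix s assume "same_outside {''w'', ''c''} s1 s \<and> 1 \<le> s ''c'' 0 \<and>
          (\<forall>x. 1 \<le> x \<and> x < s ''c'' 0 \<longrightarrow> r < s1 ''used'' x) \<and>
          (r < s1 ''used'' (s ''c'' 0) \<longrightarrow> s ''c'' 0 = n + 1)"
        then have so: "same_outside {''w'', ''c''} s1 s" and c: "1 \<le> s ''c'' 0"
          "\<And>x. 1 \<le> x \<Longrightarrow> x < s ''c'' 0 \<Longrightarrow> r < s1 ''used'' x" "r < s1 ''used'' (s ''c'' 0) \<Longrightarrow> s ''c'' 0 = n + 1"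
          by simp_all
        have eqs: "s ''v'' = s1 ''v''" "s ''r'' = s1 ''r''" "s ''col'' = s1 ''col''" "s ''used'' = s1 ''used''"
          by (rule same_outsideD[OF so]; simp)+
        have so': "same_outside M s0 s"
          by (rule same_outside_trans[OF _ so]) (use s1 in \<open>simp_all add: M_def\<close>)
        have used: "r < s1 ''used'' x \<longleftrightarrow> (\<exists>w<n. E v w \<and> s1 ''col'' w = x)" for x using s1 by blast
        have "partial_coloring (insert v (S r)) ((s1 ''col'')(v := s ''c'' 0))"
          by (rule partial_coloring_insert[OF _ sub v vS degree c(1)]) (use s1 c(2,3) used in blast)+
        then show "?T s" using s1 so' by (simp add: eqs)
      qed (use s1 in simp_all)
    next
      fix s assume s: "same_outside M s0 s \<and> (\<forall>x. s ''used'' x \<le> Suc r) \<and> s ''r'' 0 = r \<and> s ''v'' 0 = v \<and>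
        partial_coloring (insert v (S r)) ((s ''col'')(v := s ''c'' 0))"
      then show "I (Suc r) (effect (Assign ''col'' (var ''v'') (var ''c'')) s) \<and>
        effect (Assign ''col'' (var ''v'') (var ''c'')) s ''r'' 0 = r"
        by (simp add: I_def S_Suc M_def)
    qed simp_all
  qed
  then show ?thesis
  proof (rule triple_conseq)
    fix s assume "s = s0"
    then show "I 0 s" using zero by (simp add: I_def S_def partial_coloring_def)
  next
    fix s assume "I n s"
    moreover have "S n = {..<n}" using onto by (simp add: S_def lessThan_atLeast0)
    ultimately show "partial_coloring {..<n} (s ''col'')" by (simp add: I_def)
  qed
qed

lemma coloring_program_correct:
  assumes n: "s0 ''n'' 0 = n" and adj: "\<And>v w. v < n \<Longrightarrow> w < n \<Longrightarrow> s0 ''adj'' (v * n + w) = (if E v w then 1 else 0)"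
    and zero: "\<And>x i. x \<noteq> ''n'' \<Longrightarrow> x \<noteq> ''adj'' \<Longrightarrow> s0 x i = 0"
  shows "triple (\<lambda>s. s = s0) (program_time n) coloring_program (\<lambda>s. partial_coloring {..<n} (s ''col''))"
  unfolding coloring_program_def program_time_def
proof (rule triple_seq[OF row_loop triple_seq[OF triple_pointwise triple_pointwise]])
  let ?M = "{''v'', ''w'', ''r'', ''deg'', ''best'', ''bestdeg'', ''gone'', ''order'', ''row''}"
  let ?P = "\<lambda>s. represents s \<and> (\<forall>x. s ''col'' x = 0) \<and> (\<forall>x. s ''used'' x = 0) \<and> peeling n (s ''order'')"
  fix s1 assume s1: "same_outside {''v'', ''row''} s0 s1 \<and> represents s1"
  then have so: "same_outside {''v'', ''row''} s0 s1" by simp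
  have z: "s1 ''col'' x = 0" "s1 ''used'' x = 0" "s1 ''gone'' x = 0" for x
    using same_outsideD[OF so] zero by simp_all
  have "represents s1" using s1 by simp
  note peel = peel_loop[OF this z(3)]
  show "triple (\<lambda>s. s = s1) (loop_time n (peel_time n)) (count_loop ''r'' peel_body) ?P"
  proof (rule triple_conseq[OF peel])
    let ?N = "{''v'', ''w'', ''r'', ''deg'', ''best'', ''bestdeg'', ''gone'', ''order''}"
    fix s assume s: "same_outside ?N s1 s \<and> peeling n (s ''order'')"
    then have so2: "same_outside ?N s1 s" by simp
    have "represents s" by (rule represents_same_outside[OF \<open>represents s1\<close> so2]) simp_all
    then show "?P s" using s z same_outsideD[OF so2] by simp
  qed simp
next
  fix s1 assume "represents s1 \<and> (\<forall>x. s1 ''col'' x = 0) \<and> (\<forall>x. s1 ''used'' x = 0) \<and> peeling n (s1 ''order'')"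
  then show "triple (\<lambda>s. s = s1) (loop_time n (color_time n)) (count_loop ''r'' color_body)
    (\<lambda>s. partial_coloring {..<n} (s ''col''))"
    by (intro color_loop) simp_all
qed (use n adj zero in simp_all)

end

definition polynomial_in_size :: "(nat \<Rightarrow> nat) \<Rightarrow> bool" where
  "polynomial_in_size g \<longleftrightarrow> (\<exists>p :: nat poly. \<forall>n. g n = poly p n)"

lemma polynomial_in_size_intros:
  "polynomial_in_size (\<lambda>n. c)"
  "polynomial_in_size (\<lambda>n. n)"
  "polynomial_in_size g \<Longrightarrow> polynomial_in_size h \<Longrightarrow> polynomial_in_size (\<lambda>n. g n + h n)"
  "polynomial_in_size g \<Longrightarrow> polynomial_in_size (\<lambda>n. loop_time n (g n))"
proof -
  show "polynomial_in_size (\<lambda>n. c)"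
    unfolding polynomial_in_size_def by (rule exI[of _ "[:c:]"]) simp
  show "polynomial_in_size (\<lambda>n. n)"
    unfolding polynomial_in_size_def by (rule exI[of _ "[:0, 1:]"]) simp
  assume "polynomial_in_size g"
  then obtain p where p: "\<And>n. g n = poly p n" by (auto simp: polynomial_in_size_def)
  show "polynomial_in_size (\<lambda>n. loop_time n (g n))"
    unfolding polynomial_in_size_def loop_time_def
    by (rule exI[of _ "[:0, 1:] * (p + [:2:]) + [:2:]"]) (simp add: p)
  assume "polynomial_in_size h"
  then obtain q where "\<And>n. h n = poly q n" by (auto simp: polynomial_in_size_def)
  then show "polynomial_in_size (\<lambda>n. g n + h n)"
    unfolding polynomial_in_size_def by (intro exI[of _ "p + q"]) (simp add: p)
qed

lemma program_time_polynomial: "polynomial_in_size program_time"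
  unfolding program_time_def color_time_def peel_time_def select_time_def
  by (intro polynomial_in_size_intros)

section \<open>Forbidden induced subgraphs and the class\<close>

text \<open>
  The isomorphism required by the definition goes from the subgraph of G to H, hence the inverse of f.
\<close>

lemma contains_inducedI:
  fixes f :: "'b \<Rightarrow> 'a"
  assumes G: "pair_graph G" and H: "pair_graph H"
    and inj: "inj_on f (pverts H)" and verts: "f ` pverts H \<subseteq> pverts G"
    and arcs: "\<And>i j. i \<in> pverts H \<Longrightarrow> j \<in> pverts H \<Longrightarrow> (f i, f j) \<in> parcs G \<longleftrightarrow> (i, j) \<in> parcs H"
  shows "contains_induced G H"
proof -
  interpret G: pair_graph G by fact
  interpret H: pair_graph H by fact
  define K where "K = \<lparr> pverts = f ` pverts H, parcs = {e \<in> parcs G. fst e \<in> f ` pverts H \<and> snd e \<in> f ` pverts H} \<rparr>"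
  have wf: "wf_digraph (with_proj K)"
    unfolding wf_digraph_wp_iff by unfold_locales (auto simp: K_def)
  have wfG: "wf_digraph (with_proj G)"
    unfolding wf_digraph_wp_iff by unfold_locales
  have "induced_subgraph (with_proj K) (with_proj G)"
    unfolding induced_subgraph_def subgraph_def compatible_def
    using wf wfG verts by (auto simp: K_def)
  moreover
  define g where "g = the_inv_into (pverts H) f"
  have gf: "g (f i) = i" if "i \<in> pverts H" for i
    unfolding g_def using inj that by (rule the_inv_into_f_f)
  define iso where "iso = \<lparr> iso_verts = g, iso_arcs = (\<lambda>e. (g (fst e), g (snd e))), iso_head = snd, iso_tail = fst \<rparr>"
  have "digraph_iso (with_proj K) (with_proj H)"
    unfolding digraph_iso_def
  proof (intro exI conjI)
    have inj_g: "inj_on g (f ` pverts H)" by (auto simp: inj_on_def gf)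
    have "inj_on (\<lambda>e. (g (fst e), g (snd e))) (parcs K)"
      using inj_g by (force simp: inj_on_def K_def)
    with wf inj_g show "pre_digraph.digraph_isomorphism (with_proj K) iso"
      unfolding pre_digraph.digraph_isomorphism_def by (simp add: iso_def K_def)
    have "g ` f ` pverts H = pverts H" using gf by (force simp: image_iff)
    moreover have "(\<lambda>e. (g (fst e), g (snd e))) ` parcs K = parcs H"
    proof (intro set_eqI iffI)
      fix e assume "e \<in> (\<lambda>e. (g (fst e), g (snd e))) ` parcs K"
      then show "e \<in> parcs H" using arcs by (auto simp: K_def gf)
    next
      fix e assume e: "e \<in> parcs H"
      then obtain i j where ij: "e = (i, j)" "i \<in> pverts H" "j \<in> pverts H"
        using H.wellformed' by (cases e) blast
      with e arcs have "(f i, f j) \<in> parcs K" by (simp add: K_def)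
      with ij show "e \<in> (\<lambda>e. (g (fst e), g (snd e))) ` parcs K"
        by (intro image_eqI[of _ _ "(f i, f j)"]) (simp_all add: gf)
    qed
    ultimately show "with_proj H = app_iso iso (with_proj K)"
      by (simp add: app_iso_def iso_def with_proj_def K_def)
  qed
  ultimately show ?thesis unfolding contains_induced_def by blast
qed

lemma pair_graph_graph_of:
  assumes "finite V" "E \<subseteq> V \<times> V" "\<And>v. (v, v) \<notin> E"
  shows "pair_graph (graph_of V E)"
proof
  show "finite (parcs (graph_of V E))"
    using assms(1,2) by (auto simp: graph_of_def intro: finite_subset[of E "V \<times> V"])
  show "symmetric (with_proj (graph_of V E))"
    by (auto simp: symmetric_def graph_of_def sym_def)
qed (use assms in \<open>auto simp: graph_of_def\<close>)

definition adjacent :: "'a pair_pre_digraph \<Rightarrow> 'a \<Rightarrow> 'a \<Rightarrow> bool" where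
  "adjacent G u v \<longleftrightarrow> (u, v) \<in> parcs G"

lemma adjacent_vertices:
  assumes "pair_graph G" "adjacent G u v"
  shows "u \<in> pverts G" "v \<in> pverts G"
proof -
  interpret pair_graph G by fact
  show "u \<in> pverts G" "v \<in> pverts G" using assms(2) wellformed' by (auto simp: adjacent_def)
qed

lemma simple_graph_adjacent:
  assumes "pair_graph G"
  shows "simple_graph (adjacent G)"
proof -
  interpret pair_graph G by fact
  show ?thesis
    by unfold_locales (use arcs_symmetric no_loops' in \<open>auto simp: adjacent_def\<close>)
qed

lemma less_Suc_cases:
  "i < (4::nat) \<longleftrightarrow> i \<in> {0, 1, 2, 3}" "i < (5::nat) \<longleftrightarrow> i \<in> {0, 1, 2, 3, 4}"
  by auto

lemma nth_map_inj: "distinct xs \<Longrightarrow> inj_on ((!) xs) {..<length xs}"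
  by (auto simp: inj_on_def nth_eq_iff_index_eq)

context
  fixes G :: "'a pair_pre_digraph"
  assumes G: "pair_graph G"
begin

interpretation simple_graph "adjacent G" using G by (rule simple_graph_adjacent)

lemma contains_induced_list:
  assumes "distinct xs" "pverts H = {..<length xs}" "pair_graph H" "set xs \<subseteq> pverts G"
    and "\<And>i j. i < length xs \<Longrightarrow> j < length xs \<Longrightarrow> adjacent G (xs ! i) (xs ! j) \<longleftrightarrow> (i, j) \<in> parcs H"
  shows "contains_induced G H"
  by (rule contains_inducedI[OF G, of _ "(!) xs"])
    (use assms nth_map_inj in \<open>auto simp: adjacent_def\<close>)

lemma square_free_graph_if_no_C4:
  assumes "\<not> contains_induced G (cycle_graph 4)"
  shows "square_free_graph (adjacent G)"
proof unfold_locales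
  fix a b c d
  assume adj: "adjacent G a b" "adjacent G b c" "adjacent G c d" "adjacent G d a" and neq: "a \<noteq> c" "b \<noteq> d"
  show "adjacent G a c \<or> adjacent G b d"
  proof (rule ccontr)
    assume n: "\<not> ?thesis"
    have "contains_induced G (cycle_graph 4)"
    proof (rule contains_induced_list[of "[a, b, c, d]"])
      show "distinct [a, b, c, d]" using adj neq adj_neq by auto
      have "v \<noteq> Suc v mod 4" for v by presburger
      then show "pair_graph (cycle_graph 4)"
        unfolding cycle_graph_def by (intro pair_graph_graph_of) auto
      show "set [a, b, c, d] \<subseteq> pverts G" using adj adjacent_vertices[OF G] by auto
      fix i j assume "i < length [a, b, c, d]" "j < length [a, b, c, d]"
      then have "i \<in> {0, 1, 2, 3}" "j \<in> {0, 1, 2, 3}" by (auto simp: less_Suc_cases)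
      then show "adjacent G ([a, b, c, d] ! i) ([a, b, c, d] ! j) \<longleftrightarrow> (i, j) \<in> parcs (cycle_graph 4)"
        using adj n adj_irrefl adj_commute
        by (elim insertE emptyE) (simp_all add: cycle_graph_def graph_of_def)
    qed (simp add: cycle_graph_def graph_of_def)
    with assms show False by contradiction
  qed
qed

lemma bull_free_if_no_bull:
  assumes "\<not> contains_induced G bull"
  shows bull_free
  unfolding bull_free_def
proof (intro allI impI, elim conjE)
  fix a b c d e
  assume adj: "adjacent G a b" "adjacent G b c" "adjacent G a c" "adjacent G d a" "adjacent G e b"
    and n: "\<not> adjacent G d b" "\<not> adjacent G d c" "\<not> adjacent G e a" "\<not> adjacent G e c"
  show "adjacent G d e"
  proof (rule ccontr)
    assume de: "\<not> ?thesis"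
    have "contains_induced G bull"
    proof (rule contains_induced_list[of "[a, b, c, d, e]"])
      show "distinct [a, b, c, d, e]" using adj n de adj_neq adj_commute by auto
      show "pair_graph bull"
        unfolding bull_def by (rule pair_graph_graph_of) auto
      show "set [a, b, c, d, e] \<subseteq> pverts G" using adj adjacent_vertices[OF G] by auto
      fix i j assume "i < length [a, b, c, d, e]" "j < length [a, b, c, d, e]"
      then have "i \<in> {0, 1, 2, 3, 4}" "j \<in> {0, 1, 2, 3, 4}" by (auto simp: less_Suc_cases)
      then show "adjacent G ([a, b, c, d, e] ! i) ([a, b, c, d, e] ! j) \<longleftrightarrow> (i, j) \<in> parcs bull"
        using adj n de adj_irrefl adj_commute
        by (elim insertE emptyE) (simp_all add: bull_def graph_of_def)
    qed (simp add: bull_def graph_of_def)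
    with assms show False by contradiction
  qed
qed

lemma hammer_free_if_no_hammer:
  assumes "\<not> contains_induced G hammer"
  shows hammer_free
  unfolding hammer_free_def
proof (intro allI impI, elim conjE)
  fix a b c d e
  assume adj: "adjacent G a b" "adjacent G b c" "adjacent G a c" "adjacent G d c" "adjacent G e d"
    and n: "\<not> adjacent G d a" "\<not> adjacent G d b" "\<not> adjacent G e a" "\<not> adjacent G e b"
  show "adjacent G e c"
  proof (rule ccontr)
    assume de: "\<not> ?thesis"
    have "contains_induced G hammer"
    proof (rule contains_induced_list[of "[a, b, c, d, e]"])
      show "distinct [a, b, c, d, e]" using adj n de adj_neq adj_commute by auto
      show "pair_graph hammer"
        unfolding hammer_def by (rule pair_graph_graph_of) auto
      show "set [a, b, c, d, e] \<subseteq> pverts G" using adj adjacent_vertices[OF G] by auto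
      fix i j assume "i < length [a, b, c, d, e]" "j < length [a, b, c, d, e]"
      then have "i \<in> {0, 1, 2, 3, 4}" "j \<in> {0, 1, 2, 3, 4}" by (auto simp: less_Suc_cases)
      then show "adjacent G ([a, b, c, d, e] ! i) ([a, b, c, d, e] ! j) \<longleftrightarrow> (i, j) \<in> parcs hammer"
        using adj n de adj_irrefl adj_commute
        by (elim insertE emptyE) (simp_all add: hammer_def graph_of_def)
    qed (simp add: hammer_def graph_of_def)
    with assms show False by contradiction
  qed
qed

lemma induced_path_map_contains_path:
  assumes f: "induced_path_map k f" and k: "2 \<le> k"
  shows "contains_induced G (path_graph k)"
proof (rule contains_inducedI[OF G])
  have adj: "adjacent G (f i) (f j) \<longleftrightarrow> j = Suc i \<or> i = Suc j" if "i < k" "j < k" for i j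
    using f that by (simp add: induced_path_map_def)
  show "pair_graph (path_graph k)"
    unfolding path_graph_def by (rule pair_graph_graph_of) auto
  show "inj_on f (pverts (path_graph k))"
    using f by (simp add: induced_path_map_def path_graph_def graph_of_def)
  have "f i \<in> pverts G" if "i < k" for i
  proof (cases "Suc i < k")
    case True
    then show ?thesis using adjacent_vertices(1)[OF G] adj[of i "Suc i"] that by blast
  next
    case False
    then have "i - 1 < k" "i = Suc (i - 1)" using that k by simp_all
    then show ?thesis using adjacent_vertices(2)[OF G] adj[of "i - 1" i] that by blast
  qed
  then show "f ` pverts (path_graph k) \<subseteq> pverts G" by (auto simp: path_graph_def graph_of_def)
  fix i j assume "i \<in> pverts (path_graph k)" "j \<in> pverts (path_graph k)"
  then have "i < k" "j < k" by (simp_all add: path_graph_def graph_of_def)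
  then show "(f i, f j) \<in> parcs G \<longleftrightarrow> (i, j) \<in> parcs (path_graph k)"
    using adj[of i j] by (auto simp: adjacent_def path_graph_def graph_of_def)
qed

lemma fork_plus_eq: "fork_plus = graph_of {..<6} {(0, 1), (0, 2), (0, 4), (4, 5), (5, 3)}"
  by (rule pair_pre_digraph.equality) (auto simp: fork_plus_def claw_def graph_of_def)

lemma fork_map_contains_fork_plus:
  assumes f: "fork_map f x"
  shows "contains_induced G fork_plus"
proof (rule contains_induced_list[of "[f 3, f 4, x, f 0, f 2, f 1]"])
  have adj: "adjacent G (f i) (f j) \<longleftrightarrow> j = Suc i \<or> i = Suc j" if "i < 5" "j < 5" for i j
    using f that by (simp add: fork_map_def induced_path_map_def)
  have inj: "inj_on f {..<5}" using f by (simp add: fork_map_def induced_path_map_def)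
  have x: "f i \<noteq> x \<and> (adjacent G (f i) x \<longleftrightarrow> i = 3)" if "i < 5" for i
    using f that by (simp add: fork_map_def)
  show "distinct [f 3, f 4, x, f 0, f 2, f 1]"
    using x inj by (simp add: inj_on_eq_iff[OF inj] eq_commute[of x])
  show "pair_graph fork_plus"
    unfolding fork_plus_eq by (rule pair_graph_graph_of) auto
  have "adjacent G (f 0) (f 1)" "adjacent G (f 2) (f 3)" "adjacent G (f 3) (f 4)" "adjacent G (f 3) x"
    using x[of 3] by (simp_all add: adj)
  from this[THEN adjacent_vertices(1)[OF G]] this[THEN adjacent_vertices(2)[OF G]]
  show "set [f 3, f 4, x, f 0, f 2, f 1] \<subseteq> pverts G" by simp
  fix i j assume "i < length [f 3, f 4, x, f 0, f 2, f 1]" "j < length [f 3, f 4, x, f 0, f 2, f 1]"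
  then have "i \<in> {0, 1, 2, 3, 4, 5}" "j \<in> {0, 1, 2, 3, 4, 5}" by auto
  then show "adjacent G ([f 3, f 4, x, f 0, f 2, f 1] ! i) ([f 3, f 4, x, f 0, f 2, f 1] ! j) \<longleftrightarrow>
      (i, j) \<in> parcs fork_plus"
    using x adj_irrefl adj_commute[of x]
    by (elim insertE emptyE) (simp_all add: adj fork_plus_eq graph_of_def)
qed (simp add: fork_plus_eq graph_of_def)

end

text \<open>
  The degree bound is used with the empty clique; the induced subgraph on X inherits all exclusions
  and the bound on cliques.
\<close>

lemma low_degree_in_free_graph:
  assumes F: "F = path_graph 7 \<or> F = fork_plus" and H: "H = bull \<or> H = hammer"
    and G: "G \<in> free_graphs {cycle_graph 4, F, H}" and X: "X \<subseteq> pverts G" "X \<noteq> {}"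
  shows "\<exists>v\<in>X. card {w \<in> X. adjacent G v w} \<le> 6 * clique_number G"
proof -
  have pg: "pair_graph G" and free: "\<not> contains_induced G (cycle_graph 4)" "\<not> contains_induced G F"
    "\<not> contains_induced G H" using G by (auto simp: free_graphs_def)
  interpret square_free_graph "adjacent G" using pg free(1) by (rule square_free_graph_if_no_C4)
  have fin: "finite (pverts G)"
    using pg by (simp add: pair_graph_def pair_digraph_def pair_fin_digraph_def pair_fin_digraph_axioms_def)
  have bh: "bull_free \<or> hammer_free"
    using H free(3) bull_free_if_no_bull[OF pg] hammer_free_if_no_hammer[OF pg] by blast
  have tree: "(\<nexists>f. induced_path_map 7 f) \<or> (\<nexists>f x. fork_map f x)"
    using F free(2) induced_path_map_contains_path[OF pg, of 7] fork_map_contains_fork_plus[OF pg] by fastforce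
  have bound: "card C \<le> clique_number G" if "C \<subseteq> X" "complete C" for C
  proof -
    have "clique G C" using that X by (auto simp: clique_def complete_def adjacent_def)
    moreover have "finite {S. clique G S}"
      by (rule finite_subset[of _ "Pow (pverts G)"]) (use fin in \<open>auto simp: clique_def\<close>)
    ultimately show ?thesis unfolding clique_number_def by (intro Max_ge) auto
  qed
  show ?thesis
    using low_degree_outside_clique[OF bh tree, of X "{}" "clique_number G"] bound X
      finite_subset[OF X(1) fin] by (simp add: complete_def)
qed

text \<open>
  The enumeration of the vertices carries the degree bound over to the graph on indices.
\<close>

lemma coloring_by_program:
  assumes G: "pair_graph G" and vs: "distinct vs" "set vs = pverts G"
    and low: "\<And>X. X \<subseteq> pverts G \<Longrightarrow> X \<noteq> {} \<Longrightarrow> \<exists>v\<in>X. card {w \<in> X. adjacent G v w} \<le> D"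
  shows "\<exists>t s c. exec coloring_program (graph_input G vs) t s \<and> t \<le> program_time (length vs) \<and>
    coloring G (D + 1) c \<and> (\<forall>i<length vs. s ''col'' i = c (vs ! i))"
proof -
  interpret G: simple_graph "adjacent G" using G by (rule simple_graph_adjacent)
  define n where "n = length vs"
  define E where "E i j \<longleftrightarrow> adjacent G (vs ! i) (vs ! j)" for i j
  have bij: "bij_betw ((!) vs) {..<n} (pverts G)"
    using vs by (simp add: n_def bij_betw_nth)
  interpret degenerate_graph n E D
  proof
    fix X assume X: "X \<subseteq> {..<n}" "X \<noteq> {}"
    have inj: "inj_on ((!) vs) X" using bij X by (auto simp: bij_betw_def intro: inj_on_subset)
    have "(!) vs ` X \<subseteq> pverts G" using bij X by (auto simp: bij_betw_def)
    then obtain v where v: "v \<in> X" "card {w \<in> (!) vs ` X. adjacent G (vs ! v) w} \<le> D"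
      using low[of "(!) vs ` X"] X by auto
    have "{w \<in> (!) vs ` X. adjacent G (vs ! v) w} = (!) vs ` {w \<in> X. E v w}" by (auto simp: E_def)
    moreover have "inj_on ((!) vs) {w \<in> X. E v w}" using inj by (rule inj_on_subset) auto
    ultimately show "\<exists>v\<in>X. card {w \<in> X. E v w} \<le> D" using v by (auto simp: card_image)
  qed (auto simp: E_def G.adj_irrefl intro: G.adj_sym)
  have "triple (\<lambda>s. s = graph_input G vs) (program_time n) coloring_program
    (\<lambda>s. partial_coloring {..<n} (s ''col''))"
  proof (rule coloring_program_correct)
    fix v w assume vw: "v < n" "w < n"
    have "v * n + w < n * n"
    proof -
      have "v * n + w < Suc v * n" using vw by simp
      also have "\<dots> \<le> n * n" using vw by (intro mult_le_mono1) simp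
      finally show ?thesis .
    qed
    then show "graph_input G vs ''adj'' (v * n + w) = (if E v w then 1 else 0)"
      using vw by (simp add: graph_input_def adjacency_matrix_def n_def[symmetric] E_def adjacent_def Let_def)
  qed (simp_all add: graph_input_def n_def)
  then obtain t s where run: "exec coloring_program (graph_input G vs) t s" "t \<le> program_time n"
    and col: "partial_coloring {..<n} (s ''col'')"
    unfolding triple_def by blast
  define c where "c v = s ''col'' (the_inv_into {..<n} ((!) vs) v)" for v
  have c: "c (vs ! i) = s ''col'' i" if "i < n" for i
    unfolding c_def using bij that by (simp add: bij_betw_def the_inv_into_f_f)
  have vert: "\<exists>i<n. v = vs ! i" if "v \<in> pverts G" for v
    using that vs by (metis in_set_conv_nth n_def)
  have "coloring G (D + 1) c"
    unfolding coloring_def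
  proof (intro conjI ballI)
    fix v assume "v \<in> pverts G"
    then show "c v \<in> {1..D + 1}" using vert[of v] c col by (auto simp: partial_coloring_def)
  next
    fix e assume "e \<in> parcs G"
    then obtain u v where e: "e = (u, v)" "adjacent G u v" by (cases e) (auto simp: adjacent_def)
    then obtain i j where ij: "i < n" "j < n" "u = vs ! i" "v = vs ! j"
      using vert adjacent_vertices[OF G] by blast
    with e have "E i j" by (simp add: E_def)
    then show "case e of (u, v) \<Rightarrow> c u \<noteq> c v"
      using e(1) ij c col by (auto simp: partial_coloring_def)
  qed
  moreover have "\<forall>i<length vs. s ''col'' i = c (vs ! i)" using c by (simp add: n_def)
  ultimately show ?thesis using run unfolding n_def by blast
qed

theorem corollary1p2:
  fixes F H :: "nat pair_pre_digraph"
  assumes "F = path_graph 7 \<or> F = fork_plus"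
    and "H = bull \<or> H = hammer"
  shows "\<exists>f. linear_function f \<and>
    chi_polydet_with f (free_graphs {cycle_graph 4, F, H} :: 'a pair_pre_digraph set)"
proof -
  let ?\<G> = "free_graphs {cycle_graph 4, F, H} :: 'a pair_pre_digraph set"
  define f where "f x = 6 * x + 1" for x :: nat
  have run: "\<exists>t s c. exec coloring_program (graph_input G vs) t s \<and> t \<le> program_time (length vs) \<and>
      coloring G (f (clique_number G)) c \<and> (\<forall>i<length vs. s ''col'' i = c (vs ! i))"
    if "G \<in> ?\<G>" "distinct vs" "set vs = pverts G" for G :: "'a pair_pre_digraph" and vs
    unfolding f_def
    by (rule coloring_by_program[OF _ that(2,3) low_degree_in_free_graph[OF assms that(1)]])
      (use that(1) in \<open>simp_all add: free_graphs_def\<close>)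
  have "linear_function f"
    unfolding linear_function_def f_def by (rule exI[of _ 6], rule exI[of _ 1]) simp
  moreover have "polynomial_function f"
    unfolding polynomial_function_def f_def by (rule exI[of _ "[:1, 6:]"]) simp
  moreover have "binding_function f ?\<G>"
    unfolding binding_function_def
  proof
    fix G assume G: "G \<in> ?\<G>"
    then have "finite (pverts G)"
      by (simp add: free_graphs_def pair_graph_def pair_digraph_def pair_fin_digraph_def pair_fin_digraph_axioms_def)
    then obtain vs where "set vs = pverts G" "distinct vs" using finite_distinct_list by blast
    then have "\<exists>c. coloring G (f (clique_number G)) c" using run[OF G] by blast
    then show "chromatic_number G \<le> f (clique_number G)"
      unfolding chromatic_number_def by (rule Least_le)
  qed
  moreover have "poly_time_colorable f ?\<G>"
  proof -
    obtain p where p: "\<And>n. program_time n = poly p n"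
      using program_time_polynomial by (auto simp: polynomial_in_size_def)
    show ?thesis
      unfolding poly_time_colorable_def
      using run unfolding p by blast
  qed
  ultimately show ?thesis unfolding chi_polydet_with_def by blast
qed

end
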